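(* Let $\mathcal H=(V,E)$ be a connected hypergraph, fix a ribbon structure on $\mathrm{Bip}\,\mathcal H$, a base node $b_0$ and a base edge $b_0b_1$. Let $\mathbf f$ be a hypertree on $E$ (respectively, on $V$). Then the (ht:$E$, cut:$V$) Bernardi process run on $\mathbf f$ (respectively, the (ht:$V$, cut:$V$) Bernardi process run on $\mathbf f$) takes each edge of $\mathrm{Bip}\,\mathcal H$ exactly once as current edge, and the current graph at the end of the process is a spanning tree of $\mathrm{Bip}\,\mathcal H$ realizing $\mathbf f$.
   Context: A hypergraph is a pair $\mathcal H=(V,E)$ with $V$ a finite set and $E$ a finite multiset of nonempty subsets of $V$. Its underlying bipartite graph $\mathrm{Bip}\,\mathcal H$ has color classes $V$ (violet nodes) and $E$ (emerald nodes), $v\in V$ being joined to $e\in E$ iff $v\in e$; $\mathcal H$ is connected if $\mathrm{Bip}\,\mathcal H$ is connected. A ribbon structure on a loopless graph is a choice, at every node $x$, of a cyclic permutation of the edges incident to $x$; for an edge $xy$, $xy^+$ denotes the edge following $xy$ in the cyclic order at $x$ (the first letter names the node at which the cyclic order is taken). Subgraphs inherit ribbon structures by restricting the cyclic orders; $xy^+_G$ denotes the successor taken in the subgraph $G$. A base node $b_0$ and an incident base edge $b_0b_1$ are fixed. For a bipartite graph with color classes $E,V$, a vector $\mathbf f:E\to\mathbb Z_{\ge 0}$ is a hypertree on $E$ if some spanning tree $T$ has degree $d_T(e)=\mathbf f(e)+1$ for all $e\in E$ (then $T$ realizes $\mathbf f$); hypertrees on $V$ are defined symmetrically. Bernardi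 processes: let $X\in\{E,V\}$ and $\mathbf f$ a hypertree on $X$. The process keeps a current graph $G$ (initially $\mathrm{Bip}\,\mathcal H$) and a current edge. (ht:$X$, cut:$V$): if $b_0\in V$ the first current edge is $b_0b_1$; if $b_0\in E$ the first current edge is $b_1b_0^+$ and $b_0b_1$ counts as traversed from its emerald endpoint. If the current edge is $ve$ ($v\in V$, $e\in E$): if $\mathbf f$ is a hypertree on $X$ in $G-ve$, then $ve$ is removed, the current graph becomes $G-ve$ and the next current edge is $ve^+_G$; otherwise $ve$ is traversed from $v$, the edge $ew:=ev^+_G$ is traversed from $e$, the graph stays $G$, and the next current edge is $we^+_G$. The process stops right before some edge would be traversed for the second time from the same endpoint. *)

theory Defs
  imports "HOL-Library.Multiset" "HOL-Combinatorics.Orbits"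
begin

text \<open>
  Simple undirected graphs are given by a set \<open>N\<close> of nodes and a set \<open>G\<close> of edges, each edge
  being a two-element set of nodes.  All subgraphs considered below have the same nodes as the
  ambient graph, so they are identified with their edge sets.
\<close>

definition connected_graph :: "'n set \<Rightarrow> 'n set set \<Rightarrow> bool" where
  "connected_graph N G \<longleftrightarrow> (\<forall>x\<in>N. \<forall>y\<in>N. (x, y) \<in> {(u, w). {u, w} \<in> G}\<^sup>*)"

definition is_cycle :: "'n set set \<Rightarrow> 'n list \<Rightarrow> bool" where
  "is_cycle G p \<longleftrightarrow> 3 \<le> length p \<and> distinct p \<and>
     (\<forall>i<length p. {p ! i, p ! (Suc i mod length p)} \<in> G)"

definition spanning_tree :: "'n set \<Rightarrow> 'n set set \<Rightarrow> 'n set set \<Rightarrow> bool" where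
  "spanning_tree N G T \<longleftrightarrow> T \<subseteq> G \<and> connected_graph N T \<and> \<not> (\<exists>p. is_cycle T p)"

definition incident :: "'n set set \<Rightarrow> 'n \<Rightarrow> 'n set set" where
  "incident G x = {a \<in> G. x \<in> a}"

definition realizes :: "'n set \<Rightarrow> 'n set set \<Rightarrow> 'n set \<Rightarrow> ('n \<Rightarrow> nat) \<Rightarrow> 'n set set \<Rightarrow> bool" where
  "realizes N G X f T \<longleftrightarrow> spanning_tree N G T \<and> (\<forall>x\<in>X. card (incident T x) = f x + 1)"

text \<open>\<open>X\<close> is meant to be a color class of \<open>G\<close>; the values of \<open>f\<close> outside \<open>X\<close> play no role.\<close>

definition hypertree :: "'n set \<Rightarrow> 'n set set \<Rightarrow> 'n set \<Rightarrow> ('n \<Rightarrow> nat) \<Rightarrow> bool" where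
  "hypertree N G X f \<longleftrightarrow> (\<exists>T. realizes N G X f T)"

text \<open>
  A ribbon structure \<open>\<rho>\<close> permutes, for each node \<open>x\<close>, the edges at \<open>x\<close> in a single cycle.
  An isolated node carries no condition beyond \<open>\<rho> x\<close> being the identity
  (\<^const>\<open>cyclic_on\<close> is false on the empty set).
\<close>

definition ribbon_structure ::
  "'n set \<Rightarrow> 'n set set \<Rightarrow> ('n \<Rightarrow> 'n set \<Rightarrow> 'n set) \<Rightarrow> bool" where
  "ribbon_structure N G \<rho> \<longleftrightarrow> (\<forall>x\<in>N. \<rho> x permutes incident G x \<and>
     (incident G x \<noteq> {} \<longrightarrow> cyclic_on (\<rho> x) (incident G x)))"

text \<open>
  The successor \<open>xy\<^sup>+\<close> of the edge \<open>a = xy\<close> at \<open>x\<close>, for the ribbon structure that the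
  subgraph \<open>G\<close> inherits: the first edge of \<open>G\<close> met when \<open>\<rho> x\<close> is iterated from \<open>a\<close>.
  If \<open>a\<close> is the only edge of \<open>G\<close> at \<open>x\<close>, it is its own successor.
\<close>

definition succ_edge :: "('n \<Rightarrow> 'n set \<Rightarrow> 'n set) \<Rightarrow> 'n set set \<Rightarrow> 'n \<Rightarrow> 'n set \<Rightarrow> 'n set" where
  "succ_edge \<rho> G x a = (\<rho> x ^^ (LEAST n. 0 < n \<and> (\<rho> x ^^ n) a \<in> G)) a"


text \<open>
  A hypergraph is a pair of a node set and a multiset of hyperedges.  The emerald nodes of its
  underlying bipartite graph are the elements of the multiset counted with multiplicity:
  \<open>Emerald S i\<close>, with \<open>i < count E S\<close>, is the \<open>i\<close>-th copy of the hyperedge \<open>S\<close>.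
\<close>

type_synonym 'v hypergraph = "'v set \<times> 'v set multiset"

definition hypergraph :: "'v hypergraph \<Rightarrow> bool" where
  "hypergraph H \<longleftrightarrow> finite (fst H) \<and> (\<forall>S \<in># snd H. S \<noteq> {} \<and> S \<subseteq> fst H)"

datatype 'v node = Violet 'v | Emerald "'v set" nat

definition violets :: "'v hypergraph \<Rightarrow> 'v node set" where
  "violets H = Violet ` fst H"

definition emeralds :: "'v hypergraph \<Rightarrow> 'v node set" where
  "emeralds H = {Emerald S i | S i. i < count (snd H) S}"

definition bip_nodes :: "'v hypergraph \<Rightarrow> 'v node set" where
  "bip_nodes H = violets H \<union> emeralds H"

definition bip_edges :: "'v hypergraph \<Rightarrow> 'v node set set" where
  "bip_edges H = {{Violet v, Emerald S i} | v S i.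
     v \<in> fst H \<and> i < count (snd H) S \<and> v \<in> S}"

definition connected_hypergraph :: "'v hypergraph \<Rightarrow> bool" where
  "connected_hypergraph H \<longleftrightarrow> hypergraph H \<and> connected_graph (bip_nodes H) (bip_edges H)"


text \<open>
  \<open>bernardi_run H \<rho> X f G c Tr cs G'\<close>: started with current graph \<open>G\<close>, current edge \<open>c\<close> and
  traversals \<open>Tr\<close> already made, the (ht:\<open>X\<close>, cut:\<open>V\<close>) process on \<open>f\<close> stops; \<open>cs\<close> lists, in
  order, the edges it takes as current edge, and \<open>G'\<close> is the current graph at the end.
  A pair \<open>(x, a) \<in> Tr\<close> records that the edge \<open>a\<close> has been traversed from its endpoint \<open>x\<close>.

  The process halts before any edge is traversed again from the same endpoint.  This may
  happen at the violet endpoint (\<open>halt_violet\<close>): then the edge about to be processed is neither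
  removed nor traversed, and it is not taken as current edge another time.  Or it may happen at
  the emerald endpoint (\<open>halt_emerald\<close>), after the current edge has been traversed from \<open>v\<close>.
\<close>

inductive bernardi_run ::
  "'v hypergraph \<Rightarrow> ('v node \<Rightarrow> 'v node set \<Rightarrow> 'v node set) \<Rightarrow> 'v node set \<Rightarrow> ('v node \<Rightarrow> nat) \<Rightarrow>
   'v node set set \<Rightarrow> 'v node set \<Rightarrow> ('v node \<times> 'v node set) set \<Rightarrow>
   'v node set list \<Rightarrow> 'v node set set \<Rightarrow> bool"
  for H \<rho> X f where
  remove:
    "\<lbrakk>v \<in> violets H; e \<in> emeralds H;
      hypertree (bip_nodes H) (G - {{v, e}}) X f;
      bernardi_run H \<rho> X f (G - {{v, e}}) (succ_edge \<rho> G v {v, e}) Tr cs G'\<rbrakk>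
     \<Longrightarrow> bernardi_run H \<rho> X f G {v, e} Tr ({v, e} # cs) G'"
| halt_violet:
    "\<lbrakk>v \<in> violets H; e \<in> emeralds H;
      \<not> hypertree (bip_nodes H) (G - {{v, e}}) X f;
      (v, {v, e}) \<in> Tr\<rbrakk>
     \<Longrightarrow> bernardi_run H \<rho> X f G {v, e} Tr [] G"
| halt_emerald:
    "\<lbrakk>v \<in> violets H; e \<in> emeralds H;
      \<not> hypertree (bip_nodes H) (G - {{v, e}}) X f;
      (v, {v, e}) \<notin> Tr;
      (e, succ_edge \<rho> G e {v, e}) \<in> Tr\<rbrakk>
     \<Longrightarrow> bernardi_run H \<rho> X f G {v, e} Tr [{v, e}] G"
| traverse:
    "\<lbrakk>v \<in> violets H; e \<in> emeralds H;
      \<not> hypertree (bip_nodes H) (G - {{v, e}}) X f;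
      (v, {v, e}) \<notin> Tr;
      w \<in> violets H; succ_edge \<rho> G e {v, e} = {e, w};
      (e, {e, w}) \<notin> Tr;
      bernardi_run H \<rho> X f G (succ_edge \<rho> G w {e, w})
        (Tr \<union> {(v, {v, e}), (e, {e, w})}) cs G'\<rbrakk>
     \<Longrightarrow> bernardi_run H \<rho> X f G {v, e} Tr ({v, e} # cs) G'"

definition bernardi_process ::
  "'v hypergraph \<Rightarrow> ('v node \<Rightarrow> 'v node set \<Rightarrow> 'v node set) \<Rightarrow> 'v node \<Rightarrow> 'v node \<Rightarrow>
   'v node set \<Rightarrow> ('v node \<Rightarrow> nat) \<Rightarrow> 'v node set list \<Rightarrow> 'v node set set \<Rightarrow> bool" where
  "bernardi_process H \<rho> b\<^sub>0 b\<^sub>1 X f cs G' \<longleftrightarrow>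
     (if b\<^sub>0 \<in> violets H
      then bernardi_run H \<rho> X f (bip_edges H) {b\<^sub>0, b\<^sub>1} {} cs G'
      else bernardi_run H \<rho> X f (bip_edges H) (succ_edge \<rho> (bip_edges H) b\<^sub>1 {b\<^sub>0, b\<^sub>1})
             {(b\<^sub>0, {b\<^sub>0, b\<^sub>1})} cs G')"

text \<open>
  The process is deterministic, so a statement that it has some outcome with a given
  property is a statement about its only outcome.
\<close>

lemma violet_emerald_edge_eq:
  assumes "v \<in> violets H" "e \<in> emeralds H" "v' \<in> violets H" "e' \<in> emeralds H"
    and "{v, e} = {v', e'}"
  shows "v = v' \<and> e = e'"
  using assms by (auto simp: violets_def emeralds_def doubleton_eq_iff)

lemma bernardi_run_deterministic:
  assumes "bernardi_run H \<rho> X f G c Tr cs G'" and "bernardi_run H \<rho> X f G c Tr cs' G''"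
  shows "cs = cs' \<and> G' = G''"
  using assms
proof (induction arbitrary: cs' G'' rule: bernardi_run.induct)
  case (remove v e G Tr cs G')
  from remove.prems show ?case
    by (cases rule: bernardi_run.cases)
      (use remove.hyps remove.IH violet_emerald_edge_eq[of v H e] in \<open>metis\<close>)+
next
  case (halt_violet v e G Tr)
  from halt_violet.prems show ?case
    by (cases rule: bernardi_run.cases)
      (use halt_violet.hyps violet_emerald_edge_eq[of v H e] in \<open>metis\<close>)+
next
  case (halt_emerald v e G Tr)
  from halt_emerald.prems show ?case
    by (cases rule: bernardi_run.cases)
      (use halt_emerald.hyps violet_emerald_edge_eq[of v H e] in \<open>metis\<close>)+
next
  case (traverse v e G Tr w cs G')
  from traverse.prems show ?case
  proof (cases rule: bernardi_run.cases)
    case (traverse v' e' w' cs'')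
    have eq: "v' = v" "e' = e"
      using violet_emerald_edge_eq[of v H e v' e'] traverse traverse.hyps
        \<open>v \<in> violets H\<close> \<open>e \<in> emeralds H\<close> by auto
    have "w' = w"
      using traverse \<open>succ_edge \<rho> G e {v, e} = {e, w}\<close> unfolding eq
      by (auto simp: doubleton_eq_iff)
    then show ?thesis using traverse eq traverse.IH by auto
  qed (use traverse.hyps violet_emerald_edge_eq[of v H e] in \<open>metis\<close>)+
qed

corollary bernardi_process_deterministic:
  assumes "bernardi_process H \<rho> b\<^sub>0 b\<^sub>1 X f cs G'" and "bernardi_process H \<rho> b\<^sub>0 b\<^sub>1 X f cs' G''"
  shows "cs = cs' \<and> G' = G''"
  using assms bernardi_run_deterministic unfolding bernardi_process_def by (metis (full_types))

end

theory Submission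
  imports Defs "HOL-Library.Transitive_Closure_Table"
begin

text \<open>
  The state of the process carries three invariants: the traversals form a walk, so their net flow
  through every cut is determined by its two ends; an edge traversed from its violet endpoint
  belongs to every realization of \<open>f\<close> in the current graph; and the edges traversed so far lie in a
  common realization \<open>T\<close>. The last one persists by an exchange argument. When an edge \<open>ew\<close> has to
  enter \<open>T\<close>, swap it for the tree edge on its fundamental cycle that shares with it its endpoint in
  \<open>X\<close>: this preserves the degrees on \<open>X\<close>, and the edge given up has not been traversed, since it is
  dispensable and net flow excludes a traversal from its emerald end only.

  Successors determine departures from arrivals. If the process wants to repeat a traversal, the
  walk is therefore closed, every visited node has all its current edges traversed in both
  directions, and by connectivity the current graph is \<open>T\<close>. In particular an edge becomes current
  twice only at the halt.
\<close>

section \<open>First return in a cyclic order\<close>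

context
  fixes \<rho> :: "'n \<Rightarrow> 'n set \<Rightarrow> 'n set" and x :: 'n and C :: "'n set set"
  assumes cyc: "cyclic_on (\<rho> x) C"
begin

text \<open>The orbit of \<open>a\<close> returns to \<open>a\<close>, which lies in
  \<open>G\<close>, so the \<open>LEAST\<close> in \<open>succ_edge\<close> is attained. The last
  property is its minimality.\<close>

lemma succ_edge_least:
  assumes "a \<in> C \<inter> G"
  obtains n where "0 < n" "(\<rho> x ^^ n) a \<in> G" "succ_edge \<rho> G x a = (\<rho> x ^^ n) a"
    "\<And>k. 0 < k \<Longrightarrow> (\<rho> x ^^ k) a \<in> G \<Longrightarrow> n \<le> k"
proof -
  let ?P = "\<lambda>n. 0 < n \<and> (\<rho> x ^^ n) a \<in> G"
  have "a \<in> orbit (\<rho> x) a"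
    using assms cyc by (auto simp: cyclic_on_alldef)
  then have ex: "\<exists>n. ?P n"
    using assms by (auto simp: orbit_altdef)
  show ?thesis
    using that[of "LEAST n. ?P n"] LeastI_ex[OF ex] Least_le[of ?P]
    by (auto simp: succ_edge_def)
qed

lemma succ_edge_in:
  assumes "a \<in> C \<inter> G"
  shows "succ_edge \<rho> G x a \<in> C \<inter> G"
  using succ_edge_least[OF assms] cyclic_on_funpow_in[OF cyc] assms by (metis IntE IntI)

lemma succ_edge_eq:
  assumes "a \<in> C" "0 < n" "(\<rho> x ^^ n) a \<in> G"
    "\<And>k. 0 < k \<Longrightarrow> (\<rho> x ^^ k) a \<in> G \<Longrightarrow> n \<le> k"
  shows "succ_edge \<rho> G x a = (\<rho> x ^^ n) a"
proof -
  have "(LEAST n. 0 < n \<and> (\<rho> x ^^ n) a \<in> G) = n"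
    using assms by (intro Least_equality) auto
  then show ?thesis by (simp add: succ_edge_def)
qed

text \<open>Iterating \<open>\<rho> x\<close> from a member of \<open>A\<close> meets
  \<open>G\<close> only at successive first returns, and these stay in \<open>A\<close>; since the
  order is a single cycle, every edge of \<open>G\<close> in it is met. Below this shows that a
  visited node is eventually visited along all its edges.\<close>

lemma succ_edge_closed:
  assumes A: "A \<subseteq> C \<inter> G" "A \<noteq> {}" and cl: "\<And>a. a \<in> A \<Longrightarrow> succ_edge \<rho> G x a \<in> A"
  shows "A = C \<inter> G"
proof
  show "C \<inter> G \<subseteq> A"
  proof
    fix t assume t: "t \<in> C \<inter> G"
    have reach: "s \<in> A \<Longrightarrow> (\<rho> x ^^ n) s \<in> G \<Longrightarrow> (\<rho> x ^^ n) s \<in> A" for n s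
    proof (induction n arbitrary: s rule: less_induct)
      case (less n)
      show ?case
      proof (cases "n = 0")
        case True
        then show ?thesis using less by simp
      next
        case False
        have "s \<in> C \<inter> G" using less.prems(1) A by auto
        then obtain k where k: "0 < k" "(\<rho> x ^^ k) s \<in> G" "succ_edge \<rho> G x s = (\<rho> x ^^ k) s"
          "\<And>j. 0 < j \<Longrightarrow> (\<rho> x ^^ j) s \<in> G \<Longrightarrow> k \<le> j"
          by (rule succ_edge_least) blast
        have "k \<le> n" using k(4)[of n] False less.prems by simp
        then have eq: "(\<rho> x ^^ (n - k)) ((\<rho> x ^^ k) s) = (\<rho> x ^^ n) s"
          by (metis comp_apply funpow_add le_add_diff_inverse2)
        have "(\<rho> x ^^ k) s \<in> A" using cl[OF less.prems(1)] k(3) by simp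
        from less.IH[of "n - k", OF _ this] show ?thesis
          using eq k(1) False less.prems(2) by simp
      qed
    qed
    obtain s where s: "s \<in> A" using A by blast
    then have "t \<in> orbit (\<rho> x) s" using A t cyc by (auto simp: cyclic_on_alldef)
    then obtain n where "t = (\<rho> x ^^ n) s" by (auto simp: orbit_altdef)
    then show "t \<in> A" using reach[OF s, of n] t by simp
  qed
qed (use A in simp)

text \<open>If two first returns coincide after \<open>j \<le> k\<close> steps, cancelling
  \<open>j\<close> steps makes \<open>s\<close> an iterate of \<open>t\<close> after
  \<open>k - j\<close> steps. As \<open>s\<close> lies in \<open>G\<close> and \<open>k\<close> is
  the first return time, \<open>k - j\<close> must be zero.\<close>

lemma succ_edge_inj:
  assumes inj: "inj (\<rho> x)"
  shows "inj_on (succ_edge \<rho> G x) (C \<inter> G)"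
proof -
  have aux: "s = t" if st: "s \<in> C \<inter> G" "t \<in> C \<inter> G"
    and j: "0 < j" and k: "\<And>i. 0 < i \<Longrightarrow> (\<rho> x ^^ i) t \<in> G \<Longrightarrow> k \<le> i"
    and eq: "(\<rho> x ^^ j) s = (\<rho> x ^^ k) t" and le: "j \<le> k" for s t j k
  proof -
    have "(\<rho> x ^^ j) s = (\<rho> x ^^ j) ((\<rho> x ^^ (k - j)) t)"
      using eq le by (metis comp_apply funpow_add le_add_diff_inverse)
    then have s: "s = (\<rho> x ^^ (k - j)) t"
      using inj_fn[OF inj] by (metis injD)
    then have "\<not> 0 < k - j" using k[of "k - j"] st j le by fastforce
    then show ?thesis using s by simp
  qed
  show ?thesis
  proof (rule inj_onI)
    fix s t assume st: "s \<in> C \<inter> G" "t \<in> C \<inter> G" "succ_edge \<rho> G x s = succ_edge \<rho> G x t"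
    obtain j where j: "0 < j" "(\<rho> x ^^ j) s \<in> G" "succ_edge \<rho> G x s = (\<rho> x ^^ j) s"
      "\<And>i. 0 < i \<Longrightarrow> (\<rho> x ^^ i) s \<in> G \<Longrightarrow> j \<le> i"
      by (rule succ_edge_least[OF st(1)]) blast
    obtain k where k: "0 < k" "(\<rho> x ^^ k) t \<in> G" "succ_edge \<rho> G x t = (\<rho> x ^^ k) t"
      "\<And>i. 0 < i \<Longrightarrow> (\<rho> x ^^ i) t \<in> G \<Longrightarrow> k \<le> i"
      by (rule succ_edge_least[OF st(2)]) blast
    show "s = t"
    proof (cases "j \<le> k")
      case True
      then show ?thesis using aux[of s t j k] st j k by simp
    next
      case False
      then show ?thesis using aux[of t s k j] st j k by simp
    qed
  qed
qed

lemma succ_edge_remove_other: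
  assumes "a \<in> C \<inter> G" "succ_edge \<rho> G x a \<noteq> c"
  shows "succ_edge \<rho> (G - {c}) x a = succ_edge \<rho> G x a"
proof -
  obtain n where n: "0 < n" "(\<rho> x ^^ n) a \<in> G" "succ_edge \<rho> G x a = (\<rho> x ^^ n) a"
    "\<And>i. 0 < i \<Longrightarrow> (\<rho> x ^^ i) a \<in> G \<Longrightarrow> n \<le> i"
    by (rule succ_edge_least[OF assms(1)]) blast
  show ?thesis using succ_edge_eq[of a n "G - {c}"] n assms by auto
qed

lemma succ_edge_neq_self:
  assumes "c \<in> C \<inter> G" "a \<in> C \<inter> G" "a \<noteq> c"
  shows "succ_edge \<rho> G x c \<noteq> c"
proof
  assume "succ_edge \<rho> G x c = c"
  then have "{c} = C \<inter> G" using assms by (intro succ_edge_closed) auto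
  then show False using assms by blast
qed

text \<open>Once \<open>c\<close> is gone, the iteration from \<open>a\<close> runs past it to the
  next return from \<open>c\<close>. That return is not \<open>c\<close> itself because
  \<open>a\<close> is another edge of \<open>G\<close> in the cycle.\<close>

lemma succ_edge_remove_next:
  assumes c: "c \<in> C \<inter> G" and a: "a \<in> C \<inter> G" "a \<noteq> c" and eq: "succ_edge \<rho> G x a = c"
  shows "succ_edge \<rho> (G - {c}) x a = succ_edge \<rho> G x c"
proof -
  obtain n where n: "0 < n" "(\<rho> x ^^ n) a \<in> G" "succ_edge \<rho> G x a = (\<rho> x ^^ n) a"
    "\<And>i. 0 < i \<Longrightarrow> (\<rho> x ^^ i) a \<in> G \<Longrightarrow> n \<le> i"
    by (rule succ_edge_least[OF a(1)]) blast
  obtain m where m: "0 < m" "(\<rho> x ^^ m) c \<in> G" "succ_edge \<rho> G x c = (\<rho> x ^^ m) c"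
    "\<And>i. 0 < i \<Longrightarrow> (\<rho> x ^^ i) c \<in> G \<Longrightarrow> m \<le> i"
    by (rule succ_edge_least[OF c]) blast
  have c': "c = (\<rho> x ^^ n) a" using n eq by simp
  have shift: "(\<rho> x ^^ (i + n)) a = (\<rho> x ^^ i) c" for i
    by (simp add: funpow_add c')
  have "succ_edge \<rho> (G - {c}) x a = (\<rho> x ^^ (m + n)) a"
  proof (rule succ_edge_eq)
    show "(\<rho> x ^^ (m + n)) a \<in> G - {c}"
      using m succ_edge_neq_self[OF c a] shift by auto
    fix k assume k: "0 < k" "(\<rho> x ^^ k) a \<in> G - {c}"
    then have "n \<le> k" "k \<noteq> n" using n(4)[of k] c' by auto
    then have "(\<rho> x ^^ (k - n)) c \<in> G" "0 < k - n" using k shift[of "k - n"] by auto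
    then show "m + n \<le> k" using m(4)[of "k - n"] by simp
  qed (use a m in auto)
  then show ?thesis using shift m by simp
qed

end

section \<open>Trees described by cuts\<close>

text \<open>The cut of \<open>S\<close>, phrased without choosing an order of the two ends.
  Connectivity and acyclicity are handled through such cuts instead of paths.\<close>

definition crosses :: "'n set \<Rightarrow> 'n set \<Rightarrow> bool" where
  "crosses S a \<longleftrightarrow> a \<inter> S \<noteq> {} \<and> \<not> a \<subseteq> S"

lemma crosses_doubleton: "crosses S {x, y} \<longleftrightarrow> (x \<in> S) \<noteq> (y \<in> S)"
  by (auto simp: crosses_def)

lemma closed_under_edges:
  assumes "(x, y) \<in> {(u, w). {u, w} \<in> G}\<^sup>*" "x \<in> S" "\<And>a. a \<in> G \<Longrightarrow> \<not> crosses S a"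
  shows "y \<in> S"
  using assms(1,2)
proof induction
  case (step y z)
  then show ?case using assms(3)[of "{y, z}"] by (auto simp: crosses_doubleton)
qed simp

lemma connected_graph_crosses:
  assumes "connected_graph N G" "x \<in> N" "x \<in> S" "y \<in> N" "y \<notin> S"
  obtains a where "a \<in> G" "crosses S a"
  using assms closed_under_edges[of x y G S] unfolding connected_graph_def by blast

lemma component_not_crossed:
  assumes "a \<in> G" "\<exists>u w. a = {u, w}"
  shows "\<not> crosses {y. (x, y) \<in> {(u, w). {u, w} \<in> G}\<^sup>*} a"
proof -
  obtain u w where a: "a = {u, w}" using assms by blast
  then have "{u, w} \<in> G" "{w, u} \<in> G" using assms by (auto simp: insert_commute)
  then show ?thesis unfolding a crosses_doubleton
    by (auto intro: rtrancl_into_rtrancl)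
qed

text \<open>Otherwise the component of some node would be a cut that no edge crosses.\<close>

lemma connected_graphI:
  assumes "\<And>a. a \<in> G \<Longrightarrow> \<exists>u w. a = {u, w}"
    and "\<And>S x y. x \<in> N \<Longrightarrow> x \<in> S \<Longrightarrow> y \<in> N \<Longrightarrow> y \<notin> S \<Longrightarrow> \<exists>a\<in>G. crosses S a"
  shows "connected_graph N G"
  unfolding connected_graph_def
proof (intro ballI, rule ccontr)
  fix x y assume xy: "x \<in> N" "y \<in> N" "(x, y) \<notin> {(u, w). {u, w} \<in> G}\<^sup>*"
  then show False
    using assms(2)[of x "{y. (x, y) \<in> {(u, w). {u, w} \<in> G}\<^sup>*}" y]
      component_not_crossed[OF _ assms(1)] by auto
qed

text \<open>This is the fundamental cut of a tree edge: \<open>S\<close> is the component of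
  \<open>x\<close> after deleting \<open>{x, y}\<close>. If it contained \<open>y\<close>, a simple
  path from \<open>x\<close> to \<open>y\<close> together with the edge would be a cycle.\<close>

lemma no_cycle_cut:
  assumes doub: "\<And>a. a \<in> T \<Longrightarrow> \<exists>u w. a = {u, w}" and nc: "\<nexists>p. is_cycle T p"
    and xy: "{x, y} \<in> T" "x \<noteq> y"
  obtains S where "x \<in> S" "y \<notin> S" "\<And>a. a \<in> T - {{x, y}} \<Longrightarrow> \<not> crosses S a"
proof -
  let ?T = "T - {{x, y}}"
  let ?R = "{(u, w). {u, w} \<in> ?T}"
  have "(x, y) \<notin> ?R\<^sup>*"
  proof
    assume "(x, y) \<in> ?R\<^sup>*"
    then have "(\<lambda>u w. {u, w} \<in> ?T)\<^sup>*\<^sup>* x y" by (simp add: rtranclp_rtrancl_eq)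
    then obtain xs where "rtrancl_path (\<lambda>u w. {u, w} \<in> ?T) x xs y"
      using rtranclp_eq_rtrancl_path by metis
    then obtain xs where p: "rtrancl_path (\<lambda>u w. {u, w} \<in> ?T) x xs y" "distinct (x # xs)"
      by (rule rtrancl_path_distinct)
    let ?p = "x # xs"
    have ne: "xs \<noteq> []" using p xy by (auto elim: rtrancl_path.cases)
    then have last: "last xs = y" using p rtrancl_path_last by metis
    have edge: "{?p ! i, ?p ! Suc i} \<in> ?T" if "i < length xs" for i
      using rtrancl_path_nth[OF p(1) that] by simp
    \<comment> \<open>A path of one step would be the deleted edge itself, so the closed path has at
      least three nodes.\<close>
    have "length xs \<noteq> 1"
    proof
      assume "length xs = 1"
      then have "xs = [y]" using last by (cases xs) auto
      then show False using edge[of 0] by auto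
    qed
    then have len: "3 \<le> length ?p" using ne by (cases xs) (auto simp: Suc_le_eq)
    have "{?p ! i, ?p ! (Suc i mod length ?p)} \<in> T" if i: "i < length ?p" for i
    proof (cases "i = length xs")
      case True
      then have "?p ! i = y" using last ne by (simp add: last_conv_nth nth_Cons')
      then show ?thesis using xy True by (simp add: insert_commute)
    next
      case False
      then show ?thesis using edge[of i] i by simp
    qed
    then have "is_cycle T ?p" using p len by (simp add: is_cycle_def)
    then show False using nc by blast
  qed
  then show ?thesis
    using that[of "{z. (x, z) \<in> ?R\<^sup>*}"] component_not_crossed[of _ ?T x] doub by auto
qed

text \<open>The cut that isolates the closing edge of a cycle would also have to be crossed by the
  rest of the cycle, which joins the same two ends.\<close>

lemma no_cycleI:
  assumes cut: "\<And>x y. {x, y} \<in> T \<Longrightarrow> x \<noteq> y \<Longrightarrow>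
      \<exists>S. x \<in> S \<and> y \<notin> S \<and> (\<forall>a\<in>T - {{x, y}}. \<not> crosses S a)"
  shows "\<nexists>p. is_cycle T p"
proof
  assume "\<exists>p. is_cycle T p"
  then obtain p where p: "3 \<le> length p" "distinct p"
    and edge: "\<And>i. i < length p \<Longrightarrow> {p ! i, p ! (Suc i mod length p)} \<in> T"
    by (auto simp: is_cycle_def)
  define n where "n = length p - 1"
  have n: "length p = Suc n" "2 \<le> n" using p by (auto simp: n_def)
  have "{p ! 0, p ! n} \<in> T" using edge[of n] n by (simp add: insert_commute)
  moreover have ne: "p ! 0 \<noteq> p ! n" using p n by (simp add: nth_eq_iff_index_eq)
  ultimately obtain S where S: "p ! 0 \<in> S" "p ! n \<notin> S"
    "\<And>a. a \<in> T - {{p ! 0, p ! n}} \<Longrightarrow> \<not> crosses S a"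
    using cut[of "p ! 0" "p ! n"] by blast
  have "i \<le> n \<Longrightarrow> p ! i \<in> S" for i
  proof (induction i)
    case (Suc i)
    have "{p ! i, p ! Suc i} \<in> T" using edge[of i] Suc n by simp
    moreover have "{p ! i, p ! Suc i} \<noteq> {p ! 0, p ! n}"
      using p n Suc.prems by (auto simp: doubleton_eq_iff nth_eq_iff_index_eq)
    ultimately have "\<not> crosses S {p ! i, p ! Suc i}" using S(3) by blast
    then show ?case using Suc by (simp add: crosses_doubleton)
  qed (use S in simp)
  then show False using S by blast
qed

text \<open>Adding \<open>{p, q}\<close> creates a fundamental cycle with exactly one further edge
  at \<open>p\<close>; that edge is \<open>{p, x}\<close>, and \<open>S\<close> is its fundamental
  cut, with \<open>x\<close> and \<open>q\<close> on the same side.\<close>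

lemma tree_exchange:
  assumes doub: "\<And>a. a \<in> T \<Longrightarrow> \<exists>u w. u \<noteq> w \<and> a = {u, w} \<and> u \<in> N \<and> w \<in> N"
    and conn: "connected_graph N T" and nc: "\<nexists>p. is_cycle T p"
    and pq: "p \<in> N" "q \<in> N" "p \<noteq> q" "{p, q} \<notin> T"
  obtains x S where "{p, x} \<in> T" "x \<in> S" "q \<in> S" "p \<notin> S"
    "\<And>a. a \<in> T - {{p, x}} \<Longrightarrow> \<not> crosses S a"
    "connected_graph N (insert {p, q} (T - {{p, x}}))"
    "\<nexists>c. is_cycle (insert {p, q} (T - {{p, x}})) c"
proof -
  let ?R = "{(u, w). {u, w} \<in> T - incident T p}"
  have doub': "\<exists>u w. a = {u, w}" if "a \<in> T" for a using doub[OF that] by blast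
  \<comment> \<open>The component of \<open>q\<close> in the tree without the edges at
    \<open>p\<close>. A tree edge leaving it must contain \<open>p\<close>, and it becomes the edge
    to be given up.\<close>
  define S\<^sub>0 where "S\<^sub>0 = {y. (q, y) \<in> ?R\<^sup>*}"
  have nc0: "\<not> crosses S\<^sub>0 a" if "a \<in> T - incident T p" for a
    unfolding S\<^sub>0_def by (rule component_not_crossed) (use that doub' in auto)
  have "q \<in> S\<^sub>0" by (simp add: S\<^sub>0_def)
  have "p \<notin> S\<^sub>0"
    using closed_under_edges[of q p "T - incident T p" "- {p}"] pq
    by (auto simp: S\<^sub>0_def crosses_def incident_def)
  obtain a where a: "a \<in> T" "crosses S\<^sub>0 a"
    using connected_graph_crosses[OF conn, of q S\<^sub>0 p] pq \<open>q \<in> S\<^sub>0\<close> \<open>p \<notin> S\<^sub>0\<close> by blast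
  then have "p \<in> a" using nc0[of a] by (auto simp: incident_def)
  then obtain x where x: "a = {p, x}" "p \<noteq> x" using doub[OF a(1)] by blast
  then have "x \<in> S\<^sub>0" using a \<open>p \<notin> S\<^sub>0\<close> by (auto simp: crosses_doubleton)
  define d where "d = {p, x}"
  have dT: "d \<in> T" using a x d_def by simp
  obtain S where S: "x \<in> S" "p \<notin> S" "\<And>a. a \<in> T - {d} \<Longrightarrow> \<not> crosses S a"
    using no_cycle_cut[OF doub' nc, of x p] a x unfolding d_def by (metis insert_commute)
  \<comment> \<open>Tree edges avoiding \<open>p\<close> join \<open>q\<close> to \<open>x\<close>;
    none of them is \<open>d\<close>, so none crosses \<open>S\<close>.\<close>
  have "q \<in> S"
  proof (rule ccontr)
    assume "q \<notin> S"
    then have "x \<in> - S"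
      using \<open>x \<in> S\<^sub>0\<close> unfolding S\<^sub>0_def mem_Collect_eq
      by (rule_tac closed_under_edges[where x = q and G = "T - incident T p"])
        (use S(3) in \<open>auto simp: crosses_def incident_def d_def\<close>)
    then show False using S by simp
  qed
  let ?T = "insert {p, q} (T - {d})"
  have conn': "connected_graph N ?T"
  proof (rule connected_graphI)
    fix U y z assume U: "y \<in> N" "y \<in> U" "z \<in> N" "z \<notin> U"
    show "\<exists>a\<in>?T. crosses U a"
    proof (rule ccontr)
      assume no: "\<not> ?thesis"
      then have pqU: "p \<in> U \<longleftrightarrow> q \<in> U" by (auto simp: crosses_doubleton)
      obtain b where b: "b \<in> T" "crosses U b" using connected_graph_crosses[OF conn] U by metis
      then have "b = d" using no by blast
      then have pxU: "p \<in> U \<longleftrightarrow> x \<notin> U" using b by (auto simp: d_def crosses_doubleton)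
      \<comment> \<open>If only \<open>d\<close> crosses \<open>U\<close>, then combining
        \<open>U\<close> with \<open>S\<close> gives a set that separates \<open>q\<close> from
        \<open>p\<close> but has both ends of \<open>d\<close> outside. No tree edge crosses it,
        contrary to connectivity.\<close>
      define W where "W = (if p \<in> U then S \<inter> U else S - U)"
      have W: "q \<in> W" "p \<notin> W" "x \<notin> W" using pqU pxU S \<open>q \<in> S\<close> by (auto simp: W_def)
      have "\<not> crosses W b" if "b \<in> T" for b
      proof (cases "b = d")
        case True
        then show ?thesis using W by (simp add: d_def crosses_doubleton)
      next
        case False
        then have "\<not> crosses S b" "\<not> crosses U b" using S(3) no that by auto
        then show ?thesis by (auto simp: W_def crosses_def)
      qed
      then show False using connected_graph_crosses[OF conn, of q W p] W pq by blast
    qed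
  qed (use doub' in blast)
  have nc': "\<nexists>c. is_cycle ?T c"
  proof (rule no_cycleI)
    fix u w assume uw: "{u, w} \<in> ?T" "u \<noteq> w"
    show "\<exists>S. u \<in> S \<and> w \<notin> S \<and> (\<forall>a\<in>?T - {{u, w}}. \<not> crosses S a)"
    proof (cases "{u, w} = {p, q}")
      case True
      show ?thesis
      proof (cases "u = q")
        case True
        then have "w = p" using \<open>{u, w} = {p, q}\<close> uw by (auto simp: doubleton_eq_iff)
        then show ?thesis using True S \<open>q \<in> S\<close> by (intro exI[of _ S]) (auto simp: insert_commute)
      next
        case False
        then have "u = p" "w = q" using \<open>{u, w} = {p, q}\<close> uw by (auto simp: doubleton_eq_iff)
        moreover have "\<not> crosses (- S) a" if "a \<in> ?T - {{p, q}}" for a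
          using S(3)[of a] that by (auto simp: crosses_def)
        ultimately show ?thesis using S \<open>q \<in> S\<close> by (intro exI[of _ "- S"]) auto
      qed
    next
      case False
      then have uwT: "{u, w} \<in> T" "{u, w} \<noteq> d" using uw by auto
      then have uwS: "u \<in> S \<longleftrightarrow> w \<in> S" using S(3)[of "{u, w}"] by (auto simp: crosses_doubleton)
      obtain U where U: "u \<in> U" "w \<notin> U" "\<And>a. a \<in> T - {{u, w}} \<Longrightarrow> \<not> crosses U a"
        using no_cycle_cut[OF doub' nc uwT(1) uw(2)] by blast
      have pxU: "p \<in> U \<longleftrightarrow> x \<in> U" using U(3)[of d] uwT dT by (auto simp: d_def crosses_doubleton)
      \<comment> \<open>A Boolean combination of \<open>S\<close> and \<open>U\<close> is crossed by
        no old edge other than \<open>d\<close> and \<open>{u, w}\<close>. It remains to choose one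
        that separates \<open>u\<close> from \<open>w\<close> and keeps \<open>p\<close> and
        \<open>q\<close> together; the choice depends on the side of \<open>S\<close> that contains
        both \<open>u\<close> and \<open>w\<close>.\<close>
      have comb: "?thesis" if W: "u \<in> W" "w \<notin> W" "p \<in> W \<longleftrightarrow> q \<in> W"
        and form: "\<And>a. \<not> crosses S a \<Longrightarrow> \<not> crosses U a \<Longrightarrow> \<not> crosses W a" for W
        using W form S(3) U(3) by (intro exI[of _ W]) (auto simp: crosses_doubleton)
      consider "p \<in> U \<longleftrightarrow> q \<in> U" | "p \<notin> U" "q \<in> U" "u \<in> S" | "p \<notin> U" "q \<in> U" "u \<notin> S"
        | "p \<in> U" "q \<notin> U" "u \<in> S" | "p \<in> U" "q \<notin> U" "u \<notin> S" by blast
      then show ?thesis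
      proof cases
        case 1
        then show ?thesis using U by (intro comb[of U]) auto
      next
        case 2
        then show ?thesis using U S uwS \<open>q \<in> S\<close>
          by (intro comb[of "- (S - U)"]) (auto simp: crosses_def)
      next
        case 3
        then show ?thesis using U S uwS \<open>q \<in> S\<close>
          by (intro comb[of "U - S"]) (auto simp: crosses_def)
      next
        case 4
        then show ?thesis using U S uwS \<open>q \<in> S\<close>
          by (intro comb[of "S \<inter> U"]) (auto simp: crosses_def)
      next
        case 5
        then show ?thesis using U S uwS \<open>q \<in> S\<close>
          by (intro comb[of "U \<union> S"]) (auto simp: crosses_def)
      qed
    qed
  qed
  show ?thesis
    using that[of x S] S \<open>q \<in> S\<close> conn' nc' dT unfolding d_def by blast
qed

section \<open>Balance of traversals\<close>

text \<open>Oriented edges: the node of a dart is the end from which the edge is traversed.\<close>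

definition darts :: "'n set set \<Rightarrow> ('n \<times> 'n set) set" where
  "darts G = {(x, a). a \<in> G \<and> x \<in> a}"

definition arrivals :: "('n \<times> 'n set) set \<Rightarrow> 'n \<Rightarrow> 'n set set" where
  "arrivals Tr x = {a. x \<in> a \<and> (\<exists>y. y \<noteq> x \<and> (y, a) \<in> Tr)}"

text \<open>
  For a dart \<open>(x, {x, y})\<close> the summand is \<open>g x - g y\<close>, so this expresses that the
  traversals form a walk from \<open>b\<close> to \<open>z\<close> as far as net flows through cuts are concerned.
\<close>

definition balanced :: "('n \<times> 'n set) set \<Rightarrow> 'n \<Rightarrow> 'n \<Rightarrow> bool" where
  "balanced Tr b z \<longleftrightarrow> (\<forall>g :: 'n \<Rightarrow> int. (\<Sum>(x, a)\<in>Tr. 2 * g x - sum g a) = g b - g z)"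

lemma finite_darts:
  assumes "finite G" "\<And>a. a \<in> G \<Longrightarrow> finite a"
  shows "finite (darts G)"
proof -
  have "darts G = (\<Union>a\<in>G. (\<lambda>x. (x, a)) ` a)" by (auto simp: darts_def)
  then show ?thesis using assms by simp
qed

lemma balanced_empty: "balanced {} b b"
  by (simp add: balanced_def)

text \<open>The new summand is \<open>g z - g y\<close>, so the sum telescopes.\<close>

lemma balanced_insert:
  assumes "finite Tr" "balanced Tr b z" "(z, {z, y}) \<notin> Tr" "z \<noteq> y"
  shows "balanced (insert (z, {z, y}) Tr) b y"
  using assms by (simp add: balanced_def)

text \<open>Balance is tested on the indicator function of \<open>S\<close>, where only darts across
  the cut contribute. The finite set \<open>D\<close> may also contain darts not traversed; this
  lets the sum be written out when the crossing edges are known.\<close>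

lemma balanced_crossing:
  assumes fin: "finite Tr" and bal: "balanced Tr b z" and Tr: "Tr \<subseteq> darts T"
    and doub: "\<And>a. a \<in> T \<Longrightarrow> \<exists>u w. u \<noteq> w \<and> a = {u, w}"
    and D: "finite D" "\<And>y a. (y, a) \<in> Tr \<Longrightarrow> crosses S a \<Longrightarrow> (y, a) \<in> D"
      "\<And>y a. (y, a) \<in> D \<Longrightarrow> crosses S a"
  shows "(\<Sum>(y, a)\<in>D. of_bool ((y, a) \<in> Tr) * (if y \<in> S then 1 else -1))
    = (of_bool (b \<in> S) - of_bool (z \<in> S) :: int)"
proof -
  let ?h = "\<lambda>(y, a). 2 * of_bool (y \<in> S) - (\<Sum>u\<in>a. of_bool (u \<in> S)) :: int"
  let ?k = "\<lambda>(y, a). of_bool ((y, a) \<in> Tr) * (if y \<in> S then 1 else -1) :: int"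
  have h: "?h (y, a) = (if crosses S a then if y \<in> S then 1 else -1 else 0)"
    if "(y, a) \<in> Tr" for y a
  proof -
    have "a \<in> T" "y \<in> a" using that Tr by (auto simp: darts_def)
    then show ?thesis using doub[of a] by (auto simp: crosses_doubleton)
  qed
  have "sum ?k D = sum ?k (D \<inter> Tr)"
    using D(1) by (intro sum.mono_neutral_right) auto
  also have "\<dots> = sum ?h (D \<inter> Tr)"
    using h D(3) by (intro sum.cong) auto
  also have "\<dots> = sum ?h Tr"
    using fin h D(2) by (intro sum.mono_neutral_left) (auto split: if_splits)
  also have "\<dots> = of_bool (b \<in> S) - of_bool (z \<in> S)"
    using bal unfolding balanced_def by simp
  finally show ?thesis .
qed

text \<open>In a tree only \<open>{p, x}\<close> crosses its fundamental cut, so the net flow into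
  \<open>S\<close> is carried by this edge alone.\<close>

lemma balanced_cut:
  assumes "finite Tr" "balanced Tr b z" "Tr \<subseteq> darts T"
    and "\<And>a. a \<in> T \<Longrightarrow> \<exists>u w. u \<noteq> w \<and> a = {u, w}"
    and S: "x \<in> S" "p \<notin> S" "\<And>a. a \<in> T - {{p, x}} \<Longrightarrow> \<not> crosses S a"
  shows "of_bool ((p, {p, x}) \<in> Tr) - of_bool ((x, {p, x}) \<in> Tr)
    = (of_bool (z \<in> S) - of_bool (b \<in> S) :: int)"
proof -
  let ?D = "{(p, {p, x}), (x, {p, x})}"
  have D1: "(y, a) \<in> ?D" if "(y, a) \<in> Tr" "crosses S a" for y a
    using that assms(3) S(3)[of a] by (auto simp: darts_def)
  have D2: "crosses S a" if "(y, a) \<in> ?D" for y a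
    using that S by (auto simp: crosses_doubleton)
  have "finite ?D" by simp
  note eq = balanced_crossing[where S = S and D = ?D, OF assms(1-4) this D1 D2]
  have "p \<noteq> x" using S by blast
  then have "- of_bool ((p, {p, x}) \<in> Tr) + of_bool ((x, {p, x}) \<in> Tr)
    = (of_bool (b \<in> S) - of_bool (z \<in> S) :: int)"
    using eq S(1,2) by (simp del: sum_of_bool_eq sum_of_bool_mult_eq)
  then show ?thesis by linarith
qed

text \<open>The union of the two fundamental cuts is crossed only by the two edges at
  \<open>p\<close>, and a walk has net flow -1, 0 or 1 into any set. Hence two edges at
  \<open>p\<close> cannot both carry a unit away from \<open>p\<close>, or both towards it.\<close>

lemma balanced_two_cuts:
  assumes "finite Tr" "balanced Tr b z" "Tr \<subseteq> darts T"
    and "\<And>a. a \<in> T \<Longrightarrow> \<exists>u w. u \<noteq> w \<and> a = {u, w}"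
    and S: "x \<in> S" "p \<notin> S" "\<And>a. a \<in> T - {{p, x}} \<Longrightarrow> \<not> crosses S a"
    and S': "y \<in> S'" "p \<notin> S'" "\<And>a. a \<in> T - {{p, y}} \<Longrightarrow> \<not> crosses S' a"
    and "x \<noteq> y"
  shows "\<bar>of_bool ((p, {p, x}) \<in> Tr) - of_bool ((x, {p, x}) \<in> Tr)
    + of_bool ((p, {p, y}) \<in> Tr) - of_bool ((y, {p, y}) \<in> Tr) :: int\<bar> \<le> 1"
proof -
  let ?D = "{(p, {p, x}), (x, {p, x}), (p, {p, y}), (y, {p, y})}"
  define U where "U = S \<union> S'"
  have U: "x \<in> U" "y \<in> U" "p \<notin> U" using S S' by (auto simp: U_def)
  have D1: "(u, a) \<in> ?D" if "(u, a) \<in> Tr" "crosses U a" for u a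
  proof -
    have "crosses S a \<or> crosses S' a" using that(2) by (auto simp: crosses_def U_def)
    moreover have "a \<in> T" "u \<in> a" using that(1) assms(3) by (auto simp: darts_def)
    ultimately have "a = {p, x} \<or> a = {p, y}" using S(3) S'(3) by blast
    then show ?thesis using \<open>u \<in> a\<close> by blast
  qed
  have D2: "crosses U a" if "(u, a) \<in> ?D" for u a
    using that U by (auto simp: crosses_doubleton)
  have "finite ?D" by simp
  note eq = balanced_crossing[where S = U and D = ?D, OF assms(1-4) this D1 D2]
  have "p \<noteq> x" "p \<noteq> y" "{p, x} \<noteq> {p, y}" using U \<open>x \<noteq> y\<close> by (auto simp: doubleton_eq_iff)
  then have "- of_bool ((p, {p, x}) \<in> Tr) + (of_bool ((x, {p, x}) \<in> Tr)
      + (- of_bool ((p, {p, y}) \<in> Tr) + of_bool ((y, {p, y}) \<in> Tr)))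
    = (of_bool (b \<in> U) - of_bool (z \<in> U) :: int)"
    using eq U \<open>x \<noteq> y\<close> by (simp del: sum_of_bool_eq sum_of_bool_mult_eq)
  moreover have "\<bar>of_bool (b \<in> U) - of_bool (z \<in> U) :: int\<bar> \<le> 1" by (simp add: of_bool_def)
  ultimately show ?thesis by linarith
qed

text \<open>Balance for the indicator function of \<open>{x}\<close>: departures count positively,
  arrivals negatively.\<close>

lemma balanced_node:
  assumes fin: "finite Tr" and bal: "balanced Tr b z" and Tr: "Tr \<subseteq> darts T"
    and doub: "\<And>a. a \<in> T \<Longrightarrow> \<exists>u w. u \<noteq> w \<and> a = {u, w}"
  shows "int (card {a. (x, a) \<in> Tr}) - int (card (arrivals Tr x))
    = of_bool (b = x) - of_bool (z = x)"
proof -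
  let ?P = "\<lambda>(y, a). y = x" and ?Q = "\<lambda>(y, a). y \<noteq> x \<and> x \<in> a"
  have split: "(2 * of_bool (y \<in> {x}) - (\<Sum>u\<in>a. of_bool (u \<in> {x})) :: int)
      = of_bool (?P (y, a)) - of_bool (?Q (y, a))" if "(y, a) \<in> Tr" for y a
  proof -
    have "a \<in> T" "y \<in> a" using that Tr by (auto simp: darts_def)
    then show ?thesis using doub[of a] by (auto simp: of_bool_def)
  qed
  have "of_bool (b = x) - of_bool (z = x)
      = (\<Sum>(y, a)\<in>Tr. 2 * of_bool (y \<in> {x}) - (\<Sum>u\<in>a. of_bool (u \<in> {x})) :: int)"
    using bal unfolding balanced_def by simp
  also have "\<dots> = (\<Sum>d\<in>Tr. of_bool (?P d) - of_bool (?Q d))"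
  proof (intro sum.cong refl)
    fix d assume "d \<in> Tr"
    then show "(case d of (y, a) \<Rightarrow> 2 * of_bool (y \<in> {x}) - (\<Sum>u\<in>a. of_bool (u \<in> {x})))
        = (of_bool (?P d) - of_bool (?Q d) :: int)"
      using split by (cases d) (simp only: prod.case)
  qed
  also have "\<dots> = int (card (Tr \<inter> Collect ?P)) - int (card (Tr \<inter> Collect ?Q))"
    using fin by (simp add: sum_subtractf)
  also have "card (Tr \<inter> Collect ?P) = card {a. (x, a) \<in> Tr}"
    by (rule bij_betw_same_card[of snd]) (force simp: bij_betw_def inj_on_def)
  also have "card (Tr \<inter> Collect ?Q) = card (arrivals Tr x)"
  proof (rule bij_betw_same_card[of snd], unfold bij_betw_def, intro conjI inj_onI)
    fix d d' assume dd: "d \<in> Tr \<inter> Collect ?Q" "d' \<in> Tr \<inter> Collect ?Q" "snd d = snd d'"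
    obtain y y' a where eq: "d = (y, a)" "d' = (y', a)" using dd(3) by (cases d; cases d') auto
    then have "y \<in> a" "y' \<in> a" "x \<in> a" "y \<noteq> x" "y' \<noteq> x" "a \<in> T"
      using dd Tr by (auto simp: darts_def)
    then show "d = d'" using doub[of a] eq by auto
  qed (force simp: arrivals_def)
  finally show ?thesis by simp
qed

section \<open>The invariant of the process\<close>

text \<open>Both processes are treated at once: \<open>X\<close> may be either color class. The node
  \<open>b\<close> is where the walk of traversals begins, whatever its color.\<close>

locale ribbon_bipartite =
  fixes V E :: "'n set" and B :: "'n set set" and \<rho> :: "'n \<Rightarrow> 'n set \<Rightarrow> 'n set"
    and X :: "'n set" and f :: "'n \<Rightarrow> nat" and b :: 'n
  assumes finite_edges: "finite B"
    and bipartite: "\<And>a. a \<in> B \<Longrightarrow> \<exists>v\<in>V. \<exists>e\<in>E. a = {v, e}"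
    and disjoint: "V \<inter> E = {}"
    and ribbon: "ribbon_structure (V \<union> E) B \<rho>"
    and X: "X = E \<or> X = V"
begin

lemma doubleton:
  assumes "a \<in> B"
  shows "\<exists>u w. u \<noteq> w \<and> a = {u, w} \<and> u \<in> V \<union> E \<and> w \<in> V \<union> E"
proof -
  obtain v e where "v \<in> V" "e \<in> E" "a = {v, e}" using bipartite[OF assms] by blast
  moreover from this have "v \<noteq> e" using disjoint by auto
  ultimately show ?thesis by blast
qed

lemma X_endpoint:
  assumes "a \<in> B"
  obtains p q where "a = {p, q}" "p \<in> X" "q \<notin> X" "p \<in> V \<union> E" "q \<in> V \<union> E"
proof -
  obtain v e where ve: "v \<in> V" "e \<in> E" "a = {v, e}" using bipartite[OF assms] by blast
  then have "v \<notin> E" "e \<notin> V" using disjoint by auto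
  then show ?thesis using that[of v e] that[of e v] ve X by (auto simp: insert_commute)
qed

lemma other_endpoint:
  assumes "a \<in> B" "z \<in> a"
  obtains y where "a = {z, y}" "z \<noteq> y" "z \<in> V \<longleftrightarrow> y \<in> E" "z \<in> E \<longleftrightarrow> y \<in> V"
proof -
  obtain v e where ve: "v \<in> V" "e \<in> E" "a = {v, e}" using bipartite[OF assms(1)] by blast
  then have "v \<notin> E" "e \<notin> V" using disjoint by auto
  then show ?thesis using that[of v] that[of e] ve assms(2) by (auto simp: insert_commute)
qed

lemma edge_colors:
  assumes "{x, y} \<in> B"
  shows "x \<in> V \<and> y \<notin> V \<and> y \<in> E \<or> y \<in> V \<and> x \<notin> V \<and> x \<in> E"
  using bipartite[OF assms] disjoint by (auto simp: doubleton_eq_iff)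

lemma finite_darts_B: "finite (darts B)"
  proof (rule finite_darts[OF finite_edges])
  fix a assume "a \<in> B"
  then show "finite a" using doubleton by fastforce
qed

section \<open>Successors within a subgraph\<close>

lemma cyclic_incident:
  assumes "a \<in> B" "y \<in> a"
  shows "cyclic_on (\<rho> y) (incident B y)" "inj (\<rho> y)"
proof -
  have "y \<in> V \<union> E" using bipartite[OF assms(1)] assms(2) by auto
  then show "cyclic_on (\<rho> y) (incident B y)" "inj (\<rho> y)"
    using ribbon assms permutes_inj by (auto simp: ribbon_structure_def incident_def)
qed

lemma incident_subgraph: "G \<subseteq> B \<Longrightarrow> incident B y \<inter> G = incident G y"
  by (auto simp: incident_def)

lemma succ_in:
  assumes "G \<subseteq> B" "a \<in> incident G y"
  shows "succ_edge \<rho> G y a \<in> incident G y"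
proof -
  have a: "a \<in> B" "y \<in> a" using assms by (auto simp: incident_def)
  show ?thesis
    using succ_edge_in[of \<rho> y "incident B y" a G, OF cyclic_incident(1)[OF a]] assms incident_subgraph[OF assms(1)]
    by simp
qed

lemma succ_inj:
  assumes "G \<subseteq> B"
  shows "inj_on (succ_edge \<rho> G y) (incident G y)"
proof (cases "incident G y = {}")
  case False
  then obtain a where a: "a \<in> B" "y \<in> a" using assms by (auto simp: incident_def)
  show ?thesis
    using succ_edge_inj[of \<rho> y "incident B y" G, OF cyclic_incident[OF a]] incident_subgraph[OF assms] by simp
qed simp

lemma succ_closed:
  assumes "G \<subseteq> B" "A \<subseteq> incident G y" "A \<noteq> {}" "\<And>a. a \<in> A \<Longrightarrow> succ_edge \<rho> G y a \<in> A"
  shows "A = incident G y"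
proof -
  obtain a where a: "a \<in> B" "y \<in> a" using assms(1-3) unfolding incident_def by blast
  show ?thesis
    using succ_edge_closed[of \<rho> y "incident B y" A G, OF cyclic_incident(1)[OF a]] assms incident_subgraph[OF assms(1)]
    by simp
qed

lemma succ_remove:
  assumes "G \<subseteq> B" "a \<in> incident G y"
  shows "succ_edge \<rho> G y a \<noteq> c \<Longrightarrow> succ_edge \<rho> (G - {c}) y a = succ_edge \<rho> G y a"
    and "succ_edge \<rho> G y a = c \<Longrightarrow> a \<noteq> c \<Longrightarrow> succ_edge \<rho> (G - {c}) y a = succ_edge \<rho> G y c"
    and "c \<in> incident G y \<Longrightarrow> a \<noteq> c \<Longrightarrow> succ_edge \<rho> G y c \<noteq> c"
proof -
  have a: "a \<in> B" "y \<in> a" "a \<in> incident B y \<inter> G"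
    using assms by (auto simp: incident_def)
  note cyc = cyclic_incident(1)[OF a(1,2)]
  show "succ_edge \<rho> (G - {c}) y a = succ_edge \<rho> G y a" if "succ_edge \<rho> G y a \<noteq> c"
    using succ_edge_remove_other[of \<rho> y "incident B y" a G c, OF cyc a(3) that] .
  show "succ_edge \<rho> (G - {c}) y a = succ_edge \<rho> G y c"
    if "succ_edge \<rho> G y a = c" "a \<noteq> c"
    using succ_edge_remove_next[of \<rho> y "incident B y" c G a, OF cyc _ a(3) that(2,1)]
      succ_in[OF assms] that(1) incident_subgraph[OF assms(1)] by simp
  show "succ_edge \<rho> G y c \<noteq> c" if "c \<in> incident G y" "a \<noteq> c"
    using succ_edge_neq_self[of \<rho> y "incident B y" c G a, OF cyc _ a(3) that(2)] that(1) incident_subgraph[OF assms(1)] by simp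
qed

section \<open>Realizations: fundamental cuts and exchange\<close>

text \<open>Used contrapositively: an edge whose removal destroys the hypertree lies in every
  realization.\<close>

lemma realizes_avoiding:
  assumes "realizes (V \<union> E) G X f T" "a \<notin> T"
  shows "hypertree (V \<union> E) (G - {a}) X f"
  using assms by (auto simp: hypertree_def realizes_def spanning_tree_def)

lemma realizes_supergraph:
  assumes "realizes (V \<union> E) G X f T" "G \<subseteq> G'"
  shows "realizes (V \<union> E) G' X f T"
  using assms by (auto simp: realizes_def spanning_tree_def)

lemma realizes_doubleton:
  assumes "realizes (V \<union> E) G X f T" "G \<subseteq> B" "a \<in> T"
  shows "\<exists>u w. u \<noteq> w \<and> a = {u, w}"
proof -
  have "a \<in> B" using assms by (auto simp: realizes_def spanning_tree_def)
  then show ?thesis using doubleton by blast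
qed

lemma realizes_cut:
  assumes "realizes (V \<union> E) G X f T" "G \<subseteq> B" "{p, x} \<in> T"
  obtains S where "x \<in> S" "p \<notin> S" "\<And>a. a \<in> T - {{p, x}} \<Longrightarrow> \<not> crosses S a"
proof (rule no_cycle_cut[of T x p])
  show "\<exists>u w. a = {u, w}" if "a \<in> T" for a
    using realizes_doubleton[OF assms(1,2) that] by blast
  show "\<nexists>c. is_cycle T c" using assms(1) by (auto simp: realizes_def spanning_tree_def)
  show "{x, p} \<in> T" using assms(3) by (simp add: insert_commute)
  show "x \<noteq> p" using realizes_doubleton[OF assms] by auto
next
  fix S assume "x \<in> S" "p \<notin> S" "\<And>a. a \<in> T - {{x, p}} \<Longrightarrow> \<not> crosses S a"
  then show thesis by (intro that[of S]) (auto simp: insert_commute)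
qed

text \<open>Both swapped edges contain \<open>p\<close>, and their other ends lie outside
  \<open>X\<close>. So \<open>p\<close> loses one edge and gains one, and no other node of
  \<open>X\<close> is affected.\<close>

lemma realizes_exchange:
  assumes T: "realizes (V \<union> E) G X f T" and G: "G \<subseteq> B" and pq: "{p, q} \<in> G" "{p, q} \<notin> T"
    and p: "p \<in> X" and q: "q \<notin> X"
  obtains x S where "{p, x} \<in> T" "x \<notin> X" "x \<in> S" "q \<in> S" "p \<notin> S"
    "\<And>a. a \<in> T - {{p, x}} \<Longrightarrow> \<not> crosses S a"
    "realizes (V \<union> E) G X f (insert {p, q} (T - {{p, x}}))"
proof -
  have TG: "T \<subseteq> G" and conn: "connected_graph (V \<union> E) T" and nc: "\<nexists>c. is_cycle T c"
    and deg: "\<And>y. y \<in> X \<Longrightarrow> card (incident T y) = f y + 1"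
    using T by (auto simp: realizes_def spanning_tree_def)
  have "{p, q} \<in> B" using pq G by blast
  then have pqN: "p \<in> V \<union> E" "q \<in> V \<union> E" "p \<noteq> q"
    using doubleton[of "{p, q}"] by (auto simp: doubleton_eq_iff)
  have "\<exists>u w. u \<noteq> w \<and> a = {u, w} \<and> u \<in> V \<union> E \<and> w \<in> V \<union> E" if "a \<in> T" for a
    using that TG G doubleton by blast
  then obtain x S where x: "{p, x} \<in> T" and S: "x \<in> S" "q \<in> S" "p \<notin> S"
    "\<And>a. a \<in> T - {{p, x}} \<Longrightarrow> \<not> crosses S a"
    and conn': "connected_graph (V \<union> E) (insert {p, q} (T - {{p, x}}))"
    and nc': "\<nexists>c. is_cycle (insert {p, q} (T - {{p, x}})) c"
    using tree_exchange[OF _ conn nc pqN pq(2)] by (metis (no_types, lifting))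
  let ?T = "insert {p, q} (T - {{p, x}})"
  have xX: "x \<notin> X"
    using X_endpoint[of "{p, x}"] x TG G p by (metis doubleton_eq_iff subsetD)
  have "card (incident ?T y) = f y + 1" if y: "y \<in> X" for y
  proof (cases "y = p")
    case True
    have eq: "incident ?T p = insert {p, q} (incident T p - {{p, x}})"
      by (auto simp: incident_def)
    have "finite (incident T p)"
      using TG G finite_edges finite_subset[of "incident T p" B] by (auto simp: incident_def)
    moreover have "{p, x} \<in> incident T p" "{p, q} \<notin> incident T p"
      using x pq by (auto simp: incident_def)
    ultimately have "card (incident ?T p) = card (incident T p)"
      unfolding eq using card_Suc_Diff1[of "incident T p" "{p, x}"] by simp
    then show ?thesis using True deg p by simp
  next
    case False
    then have "incident ?T y = incident T y" using y q xX by (auto simp: incident_def)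
    then show ?thesis using deg y by simp
  qed
  then have "realizes (V \<union> E) G X f ?T"
    using TG pq conn' nc' by (auto simp: realizes_def spanning_tree_def)
  then show ?thesis using that[of x S] x xX S by blast
qed

text \<open>
  A state: current graph \<open>G\<close>, current node \<open>z\<close> (of either color), the edge \<open>c\<close> to be
  processed next at \<open>z\<close>, and the traversals \<open>Tr\<close> made so far.
\<close>

definition invariant :: "'n set set \<Rightarrow> 'n \<Rightarrow> 'n set \<Rightarrow> ('n \<times> 'n set) set \<Rightarrow> bool" where
  "invariant G z c Tr \<longleftrightarrow> G \<subseteq> B \<and> c \<in> G \<and> z \<in> c \<and> balanced Tr b z \<and>
     (\<exists>T. realizes (V \<union> E) G X f T \<and> Tr \<subseteq> darts T) \<and>
     (\<forall>v\<in>V. \<forall>a. (v, a) \<in> Tr \<longrightarrow> \<not> hypertree (V \<union> E) (G - {a}) X f) \<and>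
     (\<forall>y a. a \<in> arrivals Tr y \<longrightarrow>
        (y, succ_edge \<rho> G y a) \<in> Tr \<or> y = z \<and> succ_edge \<rho> G y a = c)"

lemma invariantE:
  assumes "invariant G z c Tr"
  obtains T where "G \<subseteq> B" "c \<in> G" "z \<in> c" "balanced Tr b z" "finite Tr"
    "realizes (V \<union> E) G X f T" "Tr \<subseteq> darts T" "T \<subseteq> G" "Tr \<subseteq> darts G"
    "\<And>v a. v \<in> V \<Longrightarrow> (v, a) \<in> Tr \<Longrightarrow> \<not> hypertree (V \<union> E) (G - {a}) X f"
    "\<And>y a. a \<in> arrivals Tr y \<Longrightarrow>
        (y, succ_edge \<rho> G y a) \<in> Tr \<or> y = z \<and> succ_edge \<rho> G y a = c"
proof -
  obtain T where T: "realizes (V \<union> E) G X f T" "Tr \<subseteq> darts T"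
    using assms by (auto simp: invariant_def)
  then have "T \<subseteq> G" by (auto simp: realizes_def spanning_tree_def)
  moreover from this have "Tr \<subseteq> darts G" using T(2) by (auto simp: darts_def)
  moreover have "finite Tr"
    using \<open>Tr \<subseteq> darts G\<close> assms finite_subset[OF _ finite_darts_B, of Tr]
    by (auto simp: invariant_def darts_def)
  ultimately show ?thesis using T that[of T] assms unfolding invariant_def by blast
qed

lemma invariant_initial:
  assumes "hypertree (V \<union> E) B X f" "c \<in> B" "b \<in> c"
  shows "invariant B b c {}"
  using assms by (auto simp: invariant_def balanced_empty hypertree_def arrivals_def)

section \<open>Traversals preserve the invariant\<close>

text \<open>The successor pending at \<open>z\<close> was \<open>c\<close>, which is now traversed;
  the only new arrival is \<open>c\<close> at \<open>y\<close>, and its successor becomes the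
  pending edge. What remains to be supplied is a realization containing \<open>c\<close> as
  well.\<close>

lemma invariant_traverse:
  assumes inv: "invariant G z c Tr" and new: "(z, c) \<notin> Tr" and c: "c = {z, y}"
    and T: "realizes (V \<union> E) G X f T" "insert (z, c) Tr \<subseteq> darts T"
    and needed: "z \<in> V \<Longrightarrow> \<not> hypertree (V \<union> E) (G - {c}) X f"
  shows "invariant G y (succ_edge \<rho> G y c) (insert (z, c) Tr)"
proof -
  obtain T' where I: "G \<subseteq> B" "c \<in> G" "balanced Tr b z" "finite Tr"
    "\<And>v a. v \<in> V \<Longrightarrow> (v, a) \<in> Tr \<Longrightarrow> \<not> hypertree (V \<union> E) (G - {a}) X f"
    "\<And>y a. a \<in> arrivals Tr y \<Longrightarrow>
        (y, succ_edge \<rho> G y a) \<in> Tr \<or> y = z \<and> succ_edge \<rho> G y a = c"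
    using invariantE[OF inv] by metis
  have "c \<in> B" using I by blast
  then have "z \<noteq> y" using doubleton[of c] c by auto
  have bal: "balanced (insert (z, c) Tr) b y"
    using balanced_insert[OF I(4,3)] new \<open>z \<noteq> y\<close> c by simp
  have succ: "succ_edge \<rho> G y c \<in> incident G y"
    using succ_in[OF I(1), of c y] I(2) c by (auto simp: incident_def)
  have order: "(y', succ_edge \<rho> G y' a) \<in> insert (z, c) Tr
      \<or> y' = y \<and> succ_edge \<rho> G y' a = succ_edge \<rho> G y c"
    if "a \<in> arrivals (insert (z, c) Tr) y'" for y' a
  proof (cases "a \<in> arrivals Tr y'")
    case True
    then show ?thesis using I(6) by blast
  next
    case False
    then have "a = c" "y' = y" using that c by (auto simp: arrivals_def)
    then show ?thesis by blast
  qed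
  show ?thesis
    unfolding invariant_def using I(1,5) succ bal T order needed
    by (auto simp: incident_def)
qed

text \<open>The edge is needed, hence already in the realization at hand.\<close>

lemma invariant_traverse_violet:
  assumes inv: "invariant G z c Tr" and new: "(z, c) \<notin> Tr" and c: "c = {z, y}"
    and z: "z \<in> V" and needed: "\<not> hypertree (V \<union> E) (G - {c}) X f"
  shows "invariant G y (succ_edge \<rho> G y c) (insert (z, c) Tr)"
proof -
  obtain T where T: "realizes (V \<union> E) G X f T" "Tr \<subseteq> darts T" "z \<in> c"
    using inv by (rule invariantE) blast
  then have "c \<in> T" using realizes_avoiding needed by blast
  then have "insert (z, c) Tr \<subseteq> darts T" using T by (auto simp: darts_def)
  then show ?thesis using invariant_traverse[OF inv new c T(1)] needed by blast
qed

text \<open>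
  The edge to be traversed from an emerald node can be exchanged into the realization without
  giving up any traversed edge: the edge leaving the tree is not needed by \<open>f\<close>, hence not yet
  traversed from its violet endpoint, and net flow prevents that it was only traversed from the
  emerald one.
\<close>

lemma invariant_traverse_emerald:
  assumes inv: "invariant G z c Tr" and new: "(z, c) \<notin> Tr" and c: "c = {z, y}"
    and z: "z \<in> E"
  shows "invariant G y (succ_edge \<rho> G y c) (insert (z, c) Tr)"
proof -
  obtain T where I: "G \<subseteq> B" "c \<in> G" "z \<in> c" "balanced Tr b z" "finite Tr"
    "realizes (V \<union> E) G X f T" "Tr \<subseteq> darts T" "T \<subseteq> G" "Tr \<subseteq> darts G"
    "\<And>v a. v \<in> V \<Longrightarrow> (v, a) \<in> Tr \<Longrightarrow> \<not> hypertree (V \<union> E) (G - {a}) X f"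
    using inv by (rule invariantE) blast
  have zV: "z \<notin> V" using z disjoint by blast
  have "\<exists>T. realizes (V \<union> E) G X f T \<and> insert (z, c) Tr \<subseteq> darts T"
  proof (cases "c \<in> T")
    case True
    then show ?thesis using I(3,6,7) by (auto simp: darts_def)
  next
    case False
    obtain p q where pq: "c = {p, q}" "p \<in> X" "q \<notin> X"
      using X_endpoint[of c] I(1,2) by blast
    obtain x S where x: "{p, x} \<in> T" "x \<notin> X" "x \<in> S" "q \<in> S" "p \<notin> S"
      "\<And>a. a \<in> T - {{p, x}} \<Longrightarrow> \<not> crosses S a"
      and T': "realizes (V \<union> E) G X f (insert {p, q} (T - {{p, x}}))"
      using realizes_exchange[OF I(6,1), of p q] I(2) False pq by blast
    let ?d = "{p, x}" and ?T = "insert {p, q} (T - {{p, x}})"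
    have dB: "?d \<in> B" using x(1) I(1,8) by blast
    have "?d \<notin> ?T" using False x(1) pq(1) by auto
    then have violet: "(u, ?d) \<notin> Tr" if "u \<in> V" for u
      using realizes_avoiding[OF T', of ?d] I(10)[OF that, of ?d] by blast
    have flow: "of_bool ((p, ?d) \<in> Tr) - of_bool ((x, ?d) \<in> Tr)
        = (of_bool (z \<in> S) - of_bool (b \<in> S) :: int)"
      using balanced_cut[OF I(5,4,7) realizes_doubleton[OF I(6,1)] x(3,5,6)] by simp
    have untraversed: "(u, ?d) \<notin> Tr" for u
    proof
      assume u: "(u, ?d) \<in> Tr"
      then have ends: "(p, ?d) \<in> Tr \<or> (x, ?d) \<in> Tr" using I(7) by (auto simp: darts_def)
      \<comment> \<open>In the first case the edge given up would carry flow into \<open>S\<close>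
        although the walk ends outside; in the second it would carry flow out of \<open>S\<close>
        although the walk ends inside.\<close>
      consider "z = p" "x \<in> V" | "z = q" "p \<in> V"
        using I(1,2,3) pq(1) zV edge_colors[OF dB] edge_colors[of p q] by blast
      then show False
      proof cases
        case 1
        then have "(x, ?d) \<notin> Tr" "(p, ?d) \<in> Tr" using violet ends by auto
        then show False using flow 1(1) x(5) by (cases "b \<in> S") simp_all
      next
        case 2
        then have "(p, ?d) \<notin> Tr" "(x, ?d) \<in> Tr" using violet ends by auto
        then show False using flow 2(1) x(4) by (cases "b \<in> S") simp_all
      qed
    qed
    have "insert (z, c) Tr \<subseteq> darts ?T"
      using I(3,7) untraversed pq(1) by (auto simp: darts_def)
    then show ?thesis using T' by blast
  qed
  then show ?thesis using invariant_traverse[OF inv new c] zV by blast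
qed

section \<open>Closed visited regions and the halt\<close>

text \<open>
  Where arrivals are closed under succession and edges are traversed both ways, a visited node
  has all its edges traversed, so the visited region spreads.
\<close>

lemma visited_region:
  assumes G: "G \<subseteq> B" and TG: "T \<subseteq> G" and Tr: "Tr \<subseteq> darts T"
    and closed: "\<And>y a. y \<in> S \<Longrightarrow> a \<in> arrivals Tr y \<Longrightarrow> succ_edge \<rho> G y a \<in> arrivals Tr y"
    and both: "\<And>x y. {x, y} \<in> T \<Longrightarrow> x \<in> S \<Longrightarrow> y \<in> S \<Longrightarrow> (x, {x, y}) \<in> Tr \<Longrightarrow> (y, {x, y}) \<in> Tr"
  defines "R \<equiv> {y \<in> S. arrivals Tr y \<noteq> {}}"
  shows "y \<in> R \<Longrightarrow> arrivals Tr y = incident G y"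
    and "a \<in> G \<Longrightarrow> crosses R a \<Longrightarrow> a \<in> T \<and> \<not> a \<subseteq> S"
proof -
  show full: "arrivals Tr y = incident G y" if "y \<in> R" for y
  proof (rule succ_closed[OF G])
    show "arrivals Tr y \<subseteq> incident G y"
      using Tr TG by (auto simp: arrivals_def darts_def incident_def)
  qed (use that closed in \<open>auto simp: R_def\<close>)
  assume a: "a \<in> G" "crosses R a"
  then obtain y where y: "y \<in> a" "y \<in> R" by (auto simp: crosses_def)
  have aB: "a \<in> B" using a G by blast
  obtain y' where y': "a = {y, y'}" "y \<noteq> y'" using other_endpoint[OF aB y(1)] by metis
  then have "y' \<notin> R" using a y by (auto simp: crosses_doubleton)
  have "a \<in> arrivals Tr y" using full[OF y(2)] a y by (auto simp: incident_def)
  then have y'a: "(y', a) \<in> Tr" using y' Tr by (auto simp: arrivals_def darts_def)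
  then have "a \<in> T" using Tr by (auto simp: darts_def)
  moreover have "\<not> a \<subseteq> S"
  proof
    assume "a \<subseteq> S"
    then have "(y, a) \<in> Tr" using both[of y' y] y'a y' \<open>a \<in> T\<close> by (auto simp: insert_commute)
    then have "a \<in> arrivals Tr y'" using y' by (auto simp: arrivals_def)
    then show False using \<open>y' \<notin> R\<close> \<open>a \<subseteq> S\<close> y' by (auto simp: R_def)
  qed
  ultimately show "a \<in> T \<and> \<not> a \<subseteq> S" by blast
qed

text \<open>With no successor pending, each arrival at \<open>z\<close> has its own departure, which
  forces the walk to be closed. Then every tree edge has net flow zero, the visited region has no
  outgoing edge in \<open>G\<close>, and so it contains all nodes. The current node may have either
  color, so both kinds of halt are covered.\<close>

lemma invariant_halt:
  assumes inv: "invariant G z c Tr" and old: "(z, c) \<in> Tr"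
  shows "realizes (V \<union> E) G X f G" and "Tr = darts G"
proof -
  obtain T where I: "G \<subseteq> B" "c \<in> G" "z \<in> c" "balanced Tr b z" "finite Tr"
    "realizes (V \<union> E) G X f T" "Tr \<subseteq> darts T" "T \<subseteq> G" "Tr \<subseteq> darts G"
    "\<And>v a. v \<in> V \<Longrightarrow> (v, a) \<in> Tr \<Longrightarrow> \<not> hypertree (V \<union> E) (G - {a}) X f"
    "\<And>y a. a \<in> arrivals Tr y \<Longrightarrow>
        (y, succ_edge \<rho> G y a) \<in> Tr \<or> y = z \<and> succ_edge \<rho> G y a = c"
    using inv by (rule invariantE) blast
  note doub = realizes_doubleton[OF I(6,1)]
  have succ: "(y, succ_edge \<rho> G y a) \<in> Tr" if "a \<in> arrivals Tr y" for y a
    using I(11)[OF that] old by auto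
  \<comment> \<open>A walk ending at a node other than its start has one arrival more than
    departures there, contrary to injectivity of the successor map.\<close>
  have "z = b"
  proof (rule ccontr)
    assume "z \<noteq> b"
    then have lt: "card {a. (z, a) \<in> Tr} < card (arrivals Tr z)"
      using balanced_node[OF I(5,4,7) doub, of z] by simp
    have "arrivals Tr z \<subseteq> incident G z"
      using I(9) by (auto simp: arrivals_def darts_def incident_def)
    then have "inj_on (succ_edge \<rho> G z) (arrivals Tr z)"
      using succ_inj[OF I(1)] inj_on_subset by blast
    moreover have "finite {a. (z, a) \<in> Tr}"
      using finite_subset[OF _ finite_imageI[OF I(5), of snd], of "{a. (z, a) \<in> Tr}"] by force
    ultimately have "card (arrivals Tr z) \<le> card {a. (z, a) \<in> Tr}"
      using succ by (intro card_inj_on_le) auto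
    then show False using lt by simp
  qed
  have both: "(y, {x, y}) \<in> Tr" if xy: "{x, y} \<in> T" "(x, {x, y}) \<in> Tr" for x y
  proof -
    obtain S where S: "y \<in> S" "x \<notin> S" "\<And>a. a \<in> T - {{x, y}} \<Longrightarrow> \<not> crosses S a"
      by (rule realizes_cut[OF I(6,1) xy(1)]) blast
    have "of_bool ((x, {x, y}) \<in> Tr) - of_bool ((y, {x, y}) \<in> Tr) = (0 :: int)"
      using balanced_cut[OF I(5,4,7) doub S] \<open>z = b\<close> by simp
    then show ?thesis using that(2) by (simp add: of_bool_def split: if_splits)
  qed
  have closed: "succ_edge \<rho> G y a \<in> arrivals Tr y" if "a \<in> arrivals Tr y" for y a
  proof -
    define s where "s = succ_edge \<rho> G y a"
    have s: "(y, s) \<in> Tr" using succ[OF that] unfolding s_def .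
    then have sT: "s \<in> T" "y \<in> s" using I(7) by (auto simp: darts_def)
    then have "s \<in> B" using I(1,8) by blast
    then obtain y' where y': "s = {y, y'}" "y \<noteq> y'"
      using sT(2) by (rule other_endpoint)
    then have "(y', s) \<in> Tr" using both[of y y'] s sT(1) by simp
    then have "s \<in> arrivals Tr y" using y' by (auto simp: arrivals_def)
    then show ?thesis by (simp add: s_def)
  qed
  define R where "R = {y \<in> UNIV. arrivals Tr y \<noteq> {}}"
  have region: "y \<in> R \<Longrightarrow> arrivals Tr y = incident G y"
    "a \<in> G \<Longrightarrow> crosses R a \<Longrightarrow> a \<in> T \<and> \<not> a \<subseteq> UNIV" for y a
    unfolding R_def using visited_region[OF I(1,8,7), of UNIV] closed both by blast+
  have uncrossed: "\<not> crosses R a" if "a \<in> G" for a using region(2)[OF that] by auto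
  obtain y where y: "c = {z, y}" "z \<noteq> y" using other_endpoint[of c z] I(1,2,3) by blast
  have "c \<in> arrivals Tr y" using old y by (auto simp: arrivals_def)
  then have "y \<in> R" by (auto simp: R_def)
  have conn: "connected_graph (V \<union> E) T" using I(6) by (simp add: realizes_def spanning_tree_def)
  have nodes: "a \<subseteq> V \<union> E" if "a \<in> G" for a using doubleton[of a] I(1) that by blast
  have "V \<union> E \<subseteq> R"
  proof
    fix x assume "x \<in> V \<union> E"
    moreover have "y \<in> V \<union> E" using nodes[OF I(2)] y by simp
    ultimately show "x \<in> R"
      using connected_graph_crosses[OF conn, of y R x] uncrossed I(8) \<open>y \<in> R\<close> by blast
  qed
  then have full: "arrivals Tr x = incident G x" if "x \<in> V \<union> E" for x
    using region(1)[of x] that by blast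
  show all: "Tr = darts G"
  proof
    show "darts G \<subseteq> Tr"
    proof
      fix d assume "d \<in> darts G"
      then obtain x a where d: "d = (x, a)" "a \<in> G" "x \<in> a" by (auto simp: darts_def)
      obtain x' where x': "a = {x, x'}" "x \<noteq> x'" using other_endpoint[of a x] I(1) d by blast
      then have "a \<in> arrivals Tr x'" using full[of x'] nodes[OF d(2)] d(2) by (auto simp: incident_def)
      then have "(x, a) \<in> Tr" using x' I(7) by (auto simp: arrivals_def darts_def)
      then show "d \<in> Tr" using d by simp
    qed
  qed (rule I(9))
  have "G \<subseteq> T"
  proof
    fix a assume "a \<in> G"
    then obtain x where "(x, a) \<in> darts G" using doubleton[of a] I(1) by (auto simp: darts_def)
    then show "a \<in> T" using all I(7) by (auto simp: darts_def)
  qed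
  then show "realizes (V \<union> E) G X f G" using I(6,8) by auto
qed

section \<open>Removal preserves the invariant\<close>

text \<open>Let \<open>S\<close> be the side of \<open>w\<close> in the tree without
  \<open>c\<close>. The walk has a net flow of one into \<open>S\<close> through \<open>c\<close>,
  so it started outside and now stands at \<open>w\<close>. Inside \<open>S\<close> it behaves like
  a closed walk, so the region visited there is left by no edge of \<open>G\<close> except
  \<open>c\<close>: deleting \<open>c\<close> disconnects \<open>G\<close>.\<close>

lemma invariant_bridge:
  assumes inv: "invariant G w c Tr" and c: "c = {w, e}"
    and entered: "(e, c) \<in> Tr" and new: "(w, c) \<notin> Tr"
  shows "\<not> hypertree (V \<union> E) (G - {c}) X f"
proof
  assume hyp: "hypertree (V \<union> E) (G - {c}) X f"
  obtain T where I: "G \<subseteq> B" "c \<in> G" "w \<in> c" "balanced Tr b w" "finite Tr"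
    "realizes (V \<union> E) G X f T" "Tr \<subseteq> darts T" "T \<subseteq> G" "Tr \<subseteq> darts G"
    "\<And>v a. v \<in> V \<Longrightarrow> (v, a) \<in> Tr \<Longrightarrow> \<not> hypertree (V \<union> E) (G - {a}) X f"
    "\<And>y a. a \<in> arrivals Tr y \<Longrightarrow>
        (y, succ_edge \<rho> G y a) \<in> Tr \<or> y = w \<and> succ_edge \<rho> G y a = c"
    using inv by (rule invariantE) blast
  note doub = realizes_doubleton[OF I(6,1)]
  have cT: "c \<in> T" using entered I(7) by (auto simp: darts_def)
  have "w \<noteq> e" using doub[OF cT] c by auto
  have "{e, w} \<in> T" using cT c by (simp add: insert_commute)
  then obtain S where S: "w \<in> S" "e \<notin> S" "\<And>a. a \<in> T - {{e, w}} \<Longrightarrow> \<not> crosses S a"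
    by (rule realizes_cut[OF I(6,1)]) blast
  have "of_bool (w \<in> S) - of_bool (b \<in> S) = (1 :: int)"
    using balanced_cut[OF I(5,4,7) doub S] entered new c by (simp add: insert_commute)
  then have "b \<notin> S" using S(1) by (simp split: if_splits)
  have both: "(y, {x, y}) \<in> Tr" if xy: "{x, y} \<in> T" "x \<in> S" "y \<in> S" "(x, {x, y}) \<in> Tr" for x y
  proof -
    have "{x, y} \<noteq> c" using that(2,3) S(2) c by auto
    then have cxy: "c \<in> T - {{x, y}}" using cT by blast
    obtain Q where Q: "y \<in> Q" "x \<notin> Q" "\<And>a. a \<in> T - {{x, y}} \<Longrightarrow> \<not> crosses Q a"
      by (rule realizes_cut[OF I(6,1) xy(1)]) blast
    have wQ: "w \<in> Q \<longleftrightarrow> e \<in> Q" using Q(3)[OF cxy] c by (auto simp: crosses_doubleton)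
    \<comment> \<open>\<open>P\<close> separates \<open>x\<close> from \<open>y\<close> as
      \<open>Q\<close> does, but leaves \<open>w\<close>, \<open>e\<close> and \<open>b\<close>
      outside. So only \<open>{x, y}\<close> crosses it in the tree, with net flow zero.\<close>
    define P where "P = (if w \<in> Q then S - Q else S \<inter> Q)"
    have P: "w \<notin> P" "e \<notin> P" "b \<notin> P" "x \<in> P \<longleftrightarrow> y \<notin> P"
      using Q that(2,3) S(2) \<open>b \<notin> S\<close> by (auto simp: P_def)
    have uncr: "\<not> crosses P a" if "a \<in> T - {{x, y}}" for a
    proof (cases "a = c")
      case True
      then show ?thesis using P c by (simp add: crosses_doubleton)
    next
      case False
      then have "\<not> crosses S a" using S(3)[of a] that c by (auto simp: insert_commute)
      moreover have "\<not> crosses Q a" using Q(3)[OF that] .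
      ultimately show ?thesis by (auto simp: P_def crosses_def)
    qed
    show ?thesis
    proof (cases "y \<in> P")
      case True
      then have "of_bool ((x, {x, y}) \<in> Tr) - of_bool ((y, {x, y}) \<in> Tr) = (0 :: int)"
        using balanced_cut[OF I(5,4,7) doub True _ uncr] P by simp
      then show ?thesis using that(4) by (simp add: of_bool_def split: if_splits)
    next
      case False
      then have "x \<in> P" using P by blast
      have uncr': "\<not> crosses P a" if "a \<in> T - {{y, x}}" for a
        using uncr that by (simp add: insert_commute)
      have "of_bool ((y, {x, y}) \<in> Tr) - of_bool ((x, {x, y}) \<in> Tr) = (0 :: int)"
        using balanced_cut[OF I(5,4,7) doub \<open>x \<in> P\<close> False uncr'] P by (simp add: insert_commute)
      then show ?thesis using that(4) by (simp add: of_bool_def split: if_splits)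
    qed
  qed
  have closed: "succ_edge \<rho> G y a \<in> arrivals Tr y" if y: "y \<in> S" and a: "a \<in> arrivals Tr y" for y a
  proof -
    define s where "s = succ_edge \<rho> G y a"
    have "s \<in> arrivals Tr y"
    \<comment> \<open>The pending successor does no harm: it is \<open>c\<close> at
      \<open>w\<close>, which already is an arrival there.\<close>
    proof (cases "y = w \<and> s = c")
      case True
      then show ?thesis using entered c \<open>w \<noteq> e\<close> by (auto simp: arrivals_def)
    next
      case False
      then have s: "(y, s) \<in> Tr" using I(11)[OF a] s_def by blast
      then have sT: "s \<in> T" "y \<in> s" using I(7) by (auto simp: darts_def)
      then have "s \<in> B" using I(1,8) by blast
      then obtain y' where y': "s = {y, y'}" "y \<noteq> y'"
        using sT(2) by (rule other_endpoint)
      have "s \<noteq> c" using s new False sT(2) c y S(2) by auto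
      then have "\<not> crosses S s" using S(3)[of s] sT(1) c by (auto simp: insert_commute)
      then have "y' \<in> S" using y' y by (simp add: crosses_doubleton)
      then have "(y', s) \<in> Tr" using both[of y y'] s sT y y' by simp
      then show ?thesis using y' by (auto simp: arrivals_def)
    qed
    then show ?thesis by (simp add: s_def)
  qed
  define R where "R = {y \<in> S. arrivals Tr y \<noteq> {}}"
  note region = visited_region[OF I(1,8,7), of S, folded R_def, OF closed both]
  have "c \<in> arrivals Tr w" using entered c \<open>w \<noteq> e\<close> by (auto simp: arrivals_def)
  then have "w \<in> R" "e \<notin> R" using S by (auto simp: R_def)
  have uncrossed: "\<not> crosses R a" if "a \<in> G - {c}" for a
  proof
    assume "crosses R a"
    then have "a \<in> T" "\<not> a \<subseteq> S" using region(2)[of a] that by blast+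
    moreover have "a \<inter> S \<noteq> {}" using \<open>crosses R a\<close> by (auto simp: crosses_def R_def)
    ultimately have "crosses S a" by (simp add: crosses_def)
    then show False using S(3)[of a] \<open>a \<in> T\<close> that c by (auto simp: insert_commute)
  qed
  obtain T\<^sub>1 where T1: "T\<^sub>1 \<subseteq> G - {c}" "connected_graph (V \<union> E) T\<^sub>1"
    using hyp by (auto simp: hypertree_def realizes_def spanning_tree_def)
  have "w \<in> V \<union> E" "e \<in> V \<union> E" using doubleton[of c] I(1,2) c by (auto simp: doubleton_eq_iff)
  then show False
    using connected_graph_crosses[OF T1(2), of w R e] \<open>w \<in> R\<close> \<open>e \<notin> R\<close> uncrossed T1(1) by blast
qed

text \<open>
  When an edge is removed, a realization avoiding it can be chosen to contain all traversed edges: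
  take one that misses as few as possible. Exchanging a missing edge in would replace another
  traversed edge at the same node, both being traversed only from their emerald endpoints; net
  flow in the old realization excludes this.
\<close>

lemma realizes_traversed:
  assumes inv: "invariant G z c Tr" and unseen: "\<And>x. (x, c) \<notin> Tr"
    and hyp: "hypertree (V \<union> E) (G - {c}) X f"
  obtains T where "realizes (V \<union> E) (G - {c}) X f T" "Tr \<subseteq> darts T"
proof -
  obtain T\<^sub>0 where I: "G \<subseteq> B" "c \<in> G" "z \<in> c" "balanced Tr b z" "finite Tr"
    "realizes (V \<union> E) G X f T\<^sub>0" "Tr \<subseteq> darts T\<^sub>0" "T\<^sub>0 \<subseteq> G" "Tr \<subseteq> darts G"
    "\<And>v a. v \<in> V \<Longrightarrow> (v, a) \<in> Tr \<Longrightarrow> \<not> hypertree (V \<union> E) (G - {a}) X f"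
    using inv by (rule invariantE) blast
  define G\<^sub>1 where "G\<^sub>1 = G - {c}"
  have G1: "G\<^sub>1 \<subseteq> B" "G\<^sub>1 \<subseteq> G" using I(1) by (auto simp: G\<^sub>1_def)
  define P where "P T \<longleftrightarrow> realizes (V \<union> E) G\<^sub>1 X f T" for T
  obtain T\<^sub>2 where "P T\<^sub>2" using hyp by (auto simp: hypertree_def P_def G\<^sub>1_def)
  then obtain T where T: "P T"
    and least: "\<And>T'. P T' \<Longrightarrow> card (snd ` Tr - T) \<le> card (snd ` Tr - T')"
    using ex_has_least_nat[of P T\<^sub>2 "\<lambda>T. card (snd ` Tr - T)"] by blast
  have needed: "(v, a) \<notin> Tr" if "v \<in> V" "P T'" "a \<notin> T'" for v a T'
  proof -
    have "realizes (V \<union> E) G X f T'"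
      using that(2) G1(2) realizes_supergraph unfolding P_def by blast
    then show ?thesis using realizes_avoiding[of G T' a] that(3) I(10)[OF that(1), of a] by blast
  qed
  have "a \<in> T" if a: "a \<in> snd ` Tr" for a
  proof (rule ccontr)
    assume aT: "a \<notin> T"
    obtain u where u: "(u, a) \<in> Tr" using a by auto
    have aT0: "a \<in> T\<^sub>0" using u I(7) by (auto simp: darts_def)
    then have aB: "a \<in> B" and aG1: "a \<in> G\<^sub>1"
      using I(1,8) u unseen by (auto simp: G\<^sub>1_def)
    obtain p q where pq: "a = {p, q}" "p \<in> X" "q \<notin> X" using X_endpoint[OF aB] by metis
    obtain x S where x: "{p, x} \<in> T" "x \<notin> X" "x \<in> S" "q \<in> S" "p \<notin> S"
      "\<And>a. a \<in> T - {{p, x}} \<Longrightarrow> \<not> crosses S a"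
      and T': "realizes (V \<union> E) G\<^sub>1 X f (insert {p, q} (T - {{p, x}}))"
      by (rule realizes_exchange[OF T[unfolded P_def] G1(1) _ _ pq(2,3)])
        (use aT aG1 pq(1) in auto)
    let ?d = "{p, x}" and ?T = "insert {p, q} (T - {{p, x}})"
    have PT': "P ?T" using T' by (simp add: P_def)
    have dB: "?d \<in> B" using x(1) T G1(1) by (auto simp: P_def realizes_def spanning_tree_def)
    have dT': "?d \<notin> ?T" using aT x(1) pq(1) by auto
    have vd: "(v, ?d) \<notin> Tr" if "v \<in> V" for v using needed[OF that PT' dT'] .
    have va: "(v, a) \<notin> Tr" if "v \<in> V" for v using needed[OF that T aT] .
    have "?d \<in> snd ` Tr"
    proof (rule ccontr)
      assume "?d \<notin> snd ` Tr"
      then have "snd ` Tr - ?T \<subset> snd ` Tr - T" using a aT pq(1) by auto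
      then have "card (snd ` Tr - ?T) < card (snd ` Tr - T)"
        using I(5) by (intro psubset_card_mono) auto
      then show False using least[OF PT'] by simp
    qed
    then obtain u' where u': "(u', ?d) \<in> Tr" by auto
    have dT0: "?d \<in> T\<^sub>0" "u' \<in> ?d" using u' I(7) by (auto simp: darts_def)
    have ends: "(p, a) \<in> Tr \<or> (q, a) \<in> Tr" "(p, ?d) \<in> Tr \<or> (x, ?d) \<in> Tr"
      using u u' dT0(2) I(7) pq(1) by (auto simp: darts_def)
    have "q \<noteq> x" using x(1) aT pq(1) by auto
    obtain S\<^sub>1 where S1: "q \<in> S\<^sub>1" "p \<notin> S\<^sub>1" "\<And>a. a \<in> T\<^sub>0 - {{p, q}} \<Longrightarrow> \<not> crosses S\<^sub>1 a"
      by (rule realizes_cut[OF I(6,1) aT0[unfolded pq(1)]]) blast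
    obtain S\<^sub>2 where S2: "x \<in> S\<^sub>2" "p \<notin> S\<^sub>2" "\<And>a. a \<in> T\<^sub>0 - {{p, x}} \<Longrightarrow> \<not> crosses S\<^sub>2 a"
      by (rule realizes_cut[OF I(6,1) dT0(1)]) blast
    have flow: "\<bar>of_bool ((p, a) \<in> Tr) - of_bool ((q, a) \<in> Tr)
        + of_bool ((p, ?d) \<in> Tr) - of_bool ((x, ?d) \<in> Tr) :: int\<bar> \<le> 1"
      using balanced_two_cuts[OF I(5,4,7) realizes_doubleton[OF I(6,1)] S1 S2 \<open>q \<noteq> x\<close>] pq(1) by simp
    \<comment> \<open>Traversals come only from emerald ends: two units towards \<open>p\<close> if
      \<open>p\<close> is violet, two units away from it otherwise.\<close>
    consider "p \<in> V" | "q \<in> V" "x \<in> V" using edge_colors[OF dB] edge_colors[of p q] aB pq(1) by blast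
    then show False
    proof cases
      case 1
      then have "(p, a) \<notin> Tr" "(p, ?d) \<notin> Tr" using va vd by auto
      then show False using ends flow by simp
    next
      case 2
      then have "(q, a) \<notin> Tr" "(x, ?d) \<notin> Tr" using va vd by auto
      then show False using ends flow by simp
    qed
  qed
  then have "Tr \<subseteq> darts T" using I(9) by (force simp: darts_def)
  then show ?thesis using that[of T] T by (simp add: P_def G\<^sub>1_def)
qed

text \<open>The removed edge has not been traversed: not from \<open>v\<close>, as it is
  dispensable, and not from \<open>e\<close>, as it would then be a bridge. Hence it can be a
  successor of an arrival only as the edge pending at \<open>v\<close>, where its own successor
  takes its place.\<close>

lemma invariant_remove:
  assumes inv: "invariant G v c Tr" and v: "v \<in> V"
    and hyp: "hypertree (V \<union> E) (G - {c}) X f"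
  shows "invariant (G - {c}) v (succ_edge \<rho> G v c) Tr"
proof -
  obtain T\<^sub>0 where I: "G \<subseteq> B" "c \<in> G" "v \<in> c" "balanced Tr b v" "finite Tr"
    "realizes (V \<union> E) G X f T\<^sub>0" "Tr \<subseteq> darts T\<^sub>0" "T\<^sub>0 \<subseteq> G" "Tr \<subseteq> darts G"
    "\<And>v a. v \<in> V \<Longrightarrow> (v, a) \<in> Tr \<Longrightarrow> \<not> hypertree (V \<union> E) (G - {a}) X f"
    "\<And>y a. a \<in> arrivals Tr y \<Longrightarrow>
        (y, succ_edge \<rho> G y a) \<in> Tr \<or> y = v \<and> succ_edge \<rho> G y a = c"
    using inv by (rule invariantE) blast
  have cB: "c \<in> B" using I(1,2) by blast
  obtain e where e: "c = {v, e}" "v \<noteq> e" using other_endpoint[OF cB I(3)] by metis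
  have vc: "(v, c) \<notin> Tr" using I(10)[OF v] hyp by blast
  have ec: "(e, c) \<notin> Tr" using invariant_bridge[OF inv e(1) _ vc] hyp by blast
  have unseen: "(x, c) \<notin> Tr" for x
    using vc ec e(1) I(9) by (auto simp: darts_def)
  obtain T where T: "realizes (V \<union> E) (G - {c}) X f T" "Tr \<subseteq> darts T"
    by (rule realizes_traversed[OF inv unseen hyp])
  have TG: "T \<subseteq> G - {c}" and conn: "connected_graph (V \<union> E) T"
    using T(1) by (auto simp: realizes_def spanning_tree_def)
  \<comment> \<open>A realization avoiding \<open>c\<close> still reaches \<open>v\<close>, so
    another edge remains there and the next current edge is not \<open>c\<close>.\<close>
  obtain a where a: "a \<in> T" "crosses {v} a"
    using connected_graph_crosses[OF conn, of v "{v}" e] doubleton[OF cB] e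
    by (auto simp: doubleton_eq_iff)
  then have a': "a \<in> incident G v" "a \<noteq> c" using TG by (auto simp: incident_def crosses_def)
  have c': "c \<in> incident G v" using I(2,3) by (simp add: incident_def)
  have "succ_edge \<rho> G v c \<in> incident G v" "succ_edge \<rho> G v c \<noteq> c"
    using succ_in[OF I(1) c'] succ_remove(3)[OF I(1) a'(1) c' a'(2)] by auto
  then have new: "succ_edge \<rho> G v c \<in> G - {c}" "v \<in> succ_edge \<rho> G v c"
    by (auto simp: incident_def)
  have order: "(y, succ_edge \<rho> (G - {c}) y a) \<in> Tr
      \<or> y = v \<and> succ_edge \<rho> (G - {c}) y a = succ_edge \<rho> G v c"
    if a: "a \<in> arrivals Tr y" for y a
  proof -
    have "a \<in> incident G y" "a \<noteq> c"
      using a I(9) unseen by (auto simp: arrivals_def darts_def incident_def)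
    note succ = succ_remove(1,2)[OF I(1) this(1), of c] this(2)
    show ?thesis
    proof (cases "succ_edge \<rho> G y a = c")
      case True
      then have "y = v" using I(11)[OF a] unseen by auto
      then show ?thesis using succ(2)[OF True succ(3)] by simp
    next
      case False
      then show ?thesis using succ(1)[OF False] I(11)[OF a] by auto
    qed
  qed
  have needed: "\<not> hypertree (V \<union> E) (G - {c} - {a}) X f" if "u \<in> V" "(u, a) \<in> Tr" for u a
    using I(10)[OF that] realizes_supergraph[of "G - {c} - {a}" _ "G - {a}"]
    unfolding hypertree_def by blast
  show ?thesis
    unfolding invariant_def using I(1,4) T new order needed by blast
qed

end

section \<open>Existence and outcome of the run\<close>

lemma ribbon_bipartite_hypergraph:
  assumes "hypergraph H" "ribbon_structure (bip_nodes H) (bip_edges H) \<rho>"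
    and "X = emeralds H \<or> X = violets H"
  shows "ribbon_bipartite (violets H) (emeralds H) (bip_edges H) \<rho> X"
proof
  let ?A = "\<Union>S\<in>set_mset (snd H). (\<lambda>(v, i). {Violet v, Emerald S i}) ` (fst H \<times> {..<count (snd H) S})"
  have "bip_edges H \<subseteq> ?A" by (fastforce simp: bip_edges_def simp flip: count_greater_zero_iff)
  moreover have "finite ?A" using assms(1) by (auto simp: hypergraph_def)
  ultimately show "finite (bip_edges H)" by (rule finite_subset)
  show "\<exists>v\<in>violets H. \<exists>e\<in>emeralds H. a = {v, e}" if "a \<in> bip_edges H" for a
    using that by (fastforce simp: bip_edges_def violets_def emeralds_def)
  show "violets H \<inter> emeralds H = {}" by (auto simp: violets_def emeralds_def)
  show "ribbon_structure (violets H \<union> emeralds H) (bip_edges H) \<rho>"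
    using assms(2) by (simp add: bip_nodes_def)
  show "X = emeralds H \<or> X = violets H" by (rule assms(3))
qed

text \<open>The edges still to become current are those of \<open>G\<close> not yet traversed from
  their violet end: being current means being removed or being traversed from there, except at a
  halt at a violet node, where nothing is left.\<close>

lemma bernardi_run_exists:
  assumes loc: "ribbon_bipartite (violets H) (emeralds H) (bip_edges H) \<rho> X"
    and "ribbon_bipartite.invariant (violets H) (emeralds H) (bip_edges H) \<rho> X f b G v c Tr"
    and "v \<in> violets H"
  shows "\<exists>cs G'. bernardi_run H \<rho> X f G c Tr cs G' \<and> distinct cs \<and>
    set cs = {a \<in> G. \<forall>u\<in>violets H. (u, a) \<notin> Tr} \<and> G' \<subseteq> G \<and>
    realizes (bip_nodes H) G' X f G'"
  using assms(2,3)
\<comment> \<open>A removal lowers the first summand, a traversal the second.\<close>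
proof (induction "card G + card (darts (bip_edges H) - Tr)" arbitrary: G v c Tr rule: less_induct)
  case less
  interpret ribbon_bipartite "violets H" "emeralds H" "bip_edges H" \<rho> X f b by (rule loc)
  note N = bip_nodes_def[of H, symmetric]
  obtain T where I: "G \<subseteq> bip_edges H" "c \<in> G" "v \<in> c" "Tr \<subseteq> darts G"
    "\<And>v a. v \<in> violets H \<Longrightarrow> (v, a) \<in> Tr \<Longrightarrow> \<not> hypertree (bip_nodes H) (G - {a}) X f"
    using less.prems(1) unfolding N[symmetric] by (rule invariantE) blast
  have v: "v \<in> violets H" by (rule less.prems(2))
  have finG: "finite G" using I(1) finite_edges finite_subset by blast
  have cB: "c \<in> bip_edges H" using I(1,2) by blast
  obtain e where e: "c = {v, e}" "v \<noteq> e" "e \<in> emeralds H"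
    using other_endpoint[OF cB I(3)] v by metis
  have ev: "e \<notin> violets H" using e(3) disjoint by blast
  show ?case
  proof (cases "hypertree (bip_nodes H) (G - {c}) X f")
    case True
    have inv: "invariant (G - {c}) v (succ_edge \<rho> G v c) Tr"
      using invariant_remove[OF less.prems] True by (simp add: N)
    have lt: "card (G - {c}) + card (darts (bip_edges H) - Tr) < card G + card (darts (bip_edges H) - Tr)"
      using card_Diff1_less[OF finG I(2)] by simp
    obtain cs G' where cs: "bernardi_run H \<rho> X f (G - {c}) (succ_edge \<rho> G v c) Tr cs G'"
      "distinct cs" "set cs = {a \<in> G - {c}. \<forall>u\<in>violets H. (u, a) \<notin> Tr}" "G' \<subseteq> G - {c}"
      "realizes (bip_nodes H) G' X f G'"
      using less.hyps[OF lt inv v] by blast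
    have "bernardi_run H \<rho> X f G c Tr (c # cs) G'"
      using bernardi_run.remove[OF v e(3)] True cs(1) unfolding e(1) by blast
    moreover have "(u, c) \<notin> Tr" if "u \<in> violets H" for u using I(5)[OF that] True by blast
    ultimately show ?thesis using cs I(2) by (intro exI[of _ "c # cs"] exI[of _ G']) auto
  next
    case False
    show ?thesis
    proof (cases "(v, c) \<in> Tr")
      case True
      have "bernardi_run H \<rho> X f G c Tr [] G"
        using bernardi_run.halt_violet[OF v e(3)] False True unfolding e(1) by blast
      moreover have "\<exists>u\<in>violets H. (u, a) \<in> Tr" if "a \<in> G" for a
        using bipartite[of a] that I(1) invariant_halt(2)[OF less.prems(1) True]
        by (auto simp: darts_def)
      ultimately show ?thesis using invariant_halt(1)[OF less.prems(1) True]
        by (intro exI[of _ "[]"] exI[of _ G]) (auto simp: N)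
    next
      case new: False
      let ?Tr = "insert (v, c) Tr" and ?d = "succ_edge \<rho> G e c"
      have inv: "invariant G e ?d ?Tr"
        using invariant_traverse_violet[OF less.prems(1) new e(1) v] False by (simp add: N)
      then have d: "?d \<in> G" "e \<in> ?d" by (auto simp: invariant_def)
      then have dB: "?d \<in> bip_edges H" using I(1) by blast
      have vd: "(e, ?d) \<in> ?Tr \<longleftrightarrow> (e, ?d) \<in> Tr" using e(2) by auto
      show ?thesis
      proof (cases "(e, ?d) \<in> Tr")
        case True
        have "bernardi_run H \<rho> X f G c Tr [c] G"
          using bernardi_run.halt_emerald[OF v e(3)] False new True unfolding e(1) by blast
        moreover have "{a \<in> G. \<forall>u\<in>violets H. (u, a) \<notin> Tr} = {c}"
        proof -
          \<comment> \<open>The last traversal, from \<open>v\<close>, completes the darts of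
            \<open>G\<close>, so \<open>c\<close> alone had lacked a violet traversal.\<close>
          have all: "?Tr = darts G" using invariant_halt(2)[OF inv] True by blast
          have "\<exists>u\<in>violets H. (u, a) \<in> Tr" if "a \<in> G" "a \<noteq> c" for a
          proof -
            have "\<exists>u\<in>violets H. (u, a) \<in> ?Tr"
              unfolding all using bipartite[of a] that I(1) by (auto simp: darts_def)
            then show ?thesis using that by auto
          qed
          moreover have "(u, c) \<notin> Tr" if "u \<in> violets H" for u
            using new that ev I(4) e(1) by (auto simp: darts_def)
          ultimately show ?thesis using I(2) by blast
        qed
        moreover have "realizes (bip_nodes H) G X f G"
          using invariant_halt(1)[OF inv] True by (simp add: N)
        ultimately show ?thesis by (intro exI[of _ "[c]"] exI[of _ G]) auto
      next
        case fresh: False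
        obtain w where w: "?d = {e, w}" "w \<in> violets H"
          using other_endpoint[OF dB d(2)] e(3) by metis
        let ?Tr' = "insert (e, ?d) ?Tr"
        have inv': "invariant G w (succ_edge \<rho> G w ?d) ?Tr'"
          using invariant_traverse_emerald[OF inv _ w(1) e(3)] fresh vd by blast
        have Tr': "Tr \<union> {(v, c), (e, ?d)} = ?Tr'" by auto
        have "(v, c) \<in> darts (bip_edges H)" using I(3) cB by (simp add: darts_def)
        then have "darts (bip_edges H) - ?Tr' \<subset> darts (bip_edges H) - Tr" using new by blast
        then have lt: "card G + card (darts (bip_edges H) - ?Tr') < card G + card (darts (bip_edges H) - Tr)"
          using finite_darts_B by (intro add_strict_left_mono psubset_card_mono) auto
        obtain cs G' where cs: "bernardi_run H \<rho> X f G (succ_edge \<rho> G w ?d) ?Tr' cs G'"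
          "distinct cs" "set cs = {a \<in> G. \<forall>u\<in>violets H. (u, a) \<notin> ?Tr'}" "G' \<subseteq> G"
          "realizes (bip_nodes H) G' X f G'"
          using less.hyps[OF lt inv' w(2)] by blast
        have "bernardi_run H \<rho> X f G c Tr (c # cs) G'"
          using bernardi_run.traverse[OF v e(3), of G X f Tr w \<rho> cs G', folded e(1)]
            False new w fresh cs(1) Tr' by simp
        moreover have "(u, c) \<notin> Tr" if "u \<in> violets H" for u
          using new that ev I(4) e(1) by (auto simp: darts_def)
        moreover have "set cs = {a \<in> G. \<forall>u\<in>violets H. (u, a) \<notin> Tr} - {c}"
          using cs(3) v ev by auto
        ultimately show ?thesis using cs(2,4,5) I(2)
          by (intro exI[of _ "c # cs"] exI[of _ G']) auto
      qed
    qed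
  qed
qed

theorem theorem4p5:
  fixes H :: "'v hypergraph"
    and \<rho> :: "'v node \<Rightarrow> 'v node set \<Rightarrow> 'v node set"
    and b\<^sub>0 b\<^sub>1 :: "'v node"
    and X :: "'v node set"
    and f :: "'v node \<Rightarrow> nat"
  assumes "connected_hypergraph H"
    and "ribbon_structure (bip_nodes H) (bip_edges H) \<rho>"
    and "{b\<^sub>0, b\<^sub>1} \<in> bip_edges H"
    and "X = emeralds H \<or> X = violets H"
    and "hypertree (bip_nodes H) (bip_edges H) X f"
  shows "\<exists>cs G'. bernardi_process H \<rho> b\<^sub>0 b\<^sub>1 X f cs G' \<and>
           distinct cs \<and> set cs = bip_edges H \<and>
           realizes (bip_nodes H) (bip_edges H) X f G'"
proof -
  let ?B = "bip_edges H" and ?c = "{b\<^sub>0, b\<^sub>1}"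
  have loc: "ribbon_bipartite (violets H) (emeralds H) ?B \<rho> X"
    using assms by (intro ribbon_bipartite_hypergraph) (simp_all add: connected_hypergraph_def)
  interpret ribbon_bipartite "violets H" "emeralds H" ?B \<rho> X f b\<^sub>0 by (rule loc)
  have init: "invariant ?B b\<^sub>0 ?c {}"
    using assms(3,5) by (intro invariant_initial) (simp_all add: bip_nodes_def)
  \<comment> \<open>Both starts reduce to this: as long as nothing has been traversed from a violet
    node, the edges still to come are all edges.\<close>
  have run: ?thesis
    if start: "bernardi_process H \<rho> b\<^sub>0 b\<^sub>1 X f = bernardi_run H \<rho> X f ?B c Tr"
      and inv: "invariant ?B v c Tr" "v \<in> violets H"
      and unseen: "\<And>u a. u \<in> violets H \<Longrightarrow> (u, a) \<notin> Tr" for v c Tr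
  proof -
    obtain cs G' where "bernardi_run H \<rho> X f ?B c Tr cs G'" "distinct cs"
      "set cs = {a \<in> ?B. \<forall>u\<in>violets H. (u, a) \<notin> Tr}" "G' \<subseteq> ?B"
      "realizes (bip_nodes H) G' X f G'"
      using bernardi_run_exists[OF loc inv] by blast
    then show ?thesis
      using start unseen realizes_supergraph[of G' G' ?B]
      by (intro exI[of _ cs] exI[of _ G']) (auto simp: bip_nodes_def)
  qed
  show ?thesis
  proof (cases "b\<^sub>0 \<in> violets H")
    case True
    then show ?thesis
      using run[OF _ init] by (simp add: bernardi_process_def fun_eq_iff)
  next
    case False
    then have b: "b\<^sub>0 \<in> emeralds H" "b\<^sub>1 \<in> violets H" using edge_colors[OF assms(3)] by auto
    \<comment> \<open>An emerald base node amounts to one emerald traversal, of the base edge, from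
      the initial state.\<close>
    have "invariant ?B b\<^sub>1 (succ_edge \<rho> ?B b\<^sub>1 ?c) {(b\<^sub>0, ?c)}"
      using invariant_traverse_emerald[OF init _ refl b(1)] by simp
    then show ?thesis
      using run[of "succ_edge \<rho> ?B b\<^sub>1 ?c" "{(b\<^sub>0, ?c)}" b\<^sub>1] b(2) False
      by (auto simp: bernardi_process_def fun_eq_iff)
  qed
qed

end
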